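(* Suppose that for each $x\in\mathbb{R}^N$ and each $\xi\in Q(x)\Lambda=\{Q(x)m: m\in\Lambda\}\subset\mathbb{R}^N$, the minimum $$\min_{m\in\Lambda}\{c(x)\cdot m:\ \xi=Q(x)m\}$$ is only attained in $L$ (i.e. every minimizer belongs to $L$). Then the optimal control problem $(P_1)$ admits a solution.
   Context: Let $T>0$, let $N,n,s$ be positive integers, $K\subset\mathbb{R}^n$ nonempty and compact (not necessarily convex), $x_0\in\mathbb{R}^N$. For $i=1,\dots,s$ let $c_i:\mathbb{R}^N\to\mathbb{R}$ be continuous, $\phi_i:\mathbb{R}^n\to\mathbb{R}$ of class $\mathcal{C}^1$, and $Q_i:\mathbb{R}^N\to\mathbb{R}^N$ Lipschitz. Write $c=(c_1,\dots,c_s)$, $\phi=(\phi_1,\dots,\phi_s)$, and let $Q(x)$ be the $N\times s$ matrix with columns $Q_1(x),\dots,Q_s(x)$. Problem $(P_1)$: minimize over $u$ $$\int_0^T\Big[\sum_{i=1}^s c_i(x(t))\phi_i(u(t))\Big]dt$$ subject to $x'(t)=\sum_{i=1}^s Q_i(x(t))\phi_i(u(t))$ in $(0,T)$, $x(0)=x_0$, and $u\in L^\infty(0,T)$ ($\mathbb{R}^n$-valued), $u(t)\in K$ for a.e. $t$. A solution is an admissible control attaining the minimum. Let $P(K)$ be the set of all Borel probability measures supported in $K$, and $$L=\{\phi(u): u\in K\}\subset\mathbb{R}^s,\qquad \Lambda=\Big\{m\in\mathbb{R}^s:\ m_i=\int_K\phi_i(\lambda)\,d\mu(\lambda),\ 1\le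 i\le s,\ \mu\in P(K)\Big\}.$$ *)

theory Defs
  imports "HOL-Probability.Probability"
begin

definition C1_function :: "('a::real_normed_vector \<Rightarrow> 'b::real_normed_vector) \<Rightarrow> bool" where
  "C1_function f \<longleftrightarrow>
     (\<exists>f'. (\<forall>x. (f has_derivative blinfun_apply (f' x)) (at x)) \<and> continuous_on UNIV f')"

text \<open>
  The classical epsilon-delta notion for functions of one real variable (not to be confused with
  absolute continuity of measures). The finite families of non-overlapping closed subintervals of
  \<open>[a, b]\<close> are the divisions \<open>D\<close> of their union.
\<close>

definition abs_continuous_on :: "real \<Rightarrow> real \<Rightarrow> (real \<Rightarrow> 'a::real_normed_vector) \<Rightarrow> bool" where
  "abs_continuous_on a b f \<longleftrightarrow>
     (\<forall>\<epsilon>>0. \<exists>\<delta>>0. \<forall>D. D division_of \<Union>D \<and> \<Union>D \<subseteq> {a..b} \<and> (\<Sum>I\<in>D. measure lborel I) < \<delta> \<longrightarrow>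
        (\<Sum>I\<in>D. norm (f (Sup I) - f (Inf I))) < \<epsilon>)"

definition L_infinity :: "real \<Rightarrow> (real \<Rightarrow> 'a::euclidean_space) \<Rightarrow> bool" where
  "L_infinity T u \<longleftrightarrow>
     u \<in> borel_measurable (lebesgue_on {0<..<T}) \<and>
     (\<exists>B. AE t in lebesgue_on {0<..<T}. norm (u t) \<le> B)"

definition vec_of :: "('s \<Rightarrow> 'a \<Rightarrow> real) \<Rightarrow> 'a \<Rightarrow> real ^ 's::finite" where
  "vec_of f a = (\<chi> i. f i a)"

definition Q_matrix :: "('s \<Rightarrow> real ^ 'N \<Rightarrow> real ^ 'N) \<Rightarrow> real ^ 'N \<Rightarrow> real ^ 's::finite ^ 'N::finite" where
  "Q_matrix Q x = (\<chi> j i. Q i x $ j)"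

text \<open>
  Since the control \<open>u\<close> is only measurable, the state is an absolutely continuous function that
  satisfies the differential equation almost everywhere in \<open>(0, T)\<close>.
\<close>

definition admissible ::
  "real \<Rightarrow> (real ^ 'n) set \<Rightarrow> real ^ 'N \<Rightarrow>
   ('s::finite \<Rightarrow> real ^ 'n \<Rightarrow> real) \<Rightarrow> ('s \<Rightarrow> real ^ 'N \<Rightarrow> real ^ 'N) \<Rightarrow>
   (real \<Rightarrow> real ^ 'N::finite) \<Rightarrow> (real \<Rightarrow> real ^ 'n::finite) \<Rightarrow> bool" where
  "admissible T K x0 \<phi> Q x u \<longleftrightarrow>
     L_infinity T u \<and>
     (AE t in lebesgue_on {0<..<T}. u t \<in> K) \<and>
     abs_continuous_on 0 T x \<and>
     x 0 = x0 \<and>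
     (AE t in lebesgue_on {0<..<T}.
        (x has_vector_derivative (\<Sum>i\<in>UNIV. \<phi> i (u t) *\<^sub>R Q i (x t))) (at t))"

text \<open>
  For admissible pairs with \<open>K\<close> compact and \<open>c\<close>, \<open>\<phi>\<close> continuous, the integrand is bounded and
  measurable, so the Bochner integral is never the default value of a non-integrable function.
\<close>

definition cost ::
  "real \<Rightarrow> ('s::finite \<Rightarrow> real ^ 'N \<Rightarrow> real) \<Rightarrow> ('s \<Rightarrow> real ^ 'n \<Rightarrow> real) \<Rightarrow>
   (real \<Rightarrow> real ^ 'N::finite) \<Rightarrow> (real \<Rightarrow> real ^ 'n::finite) \<Rightarrow> real" where
  "cost T c \<phi> x u = (LINT t|lebesgue_on {0<..<T}. (\<Sum>i\<in>UNIV. c i (x t) * \<phi> i (u t)))"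

text \<open>
  The problem is a minimization over pairs of a control \<open>u\<close> and a corresponding state \<open>x\<close>; for
  Lipschitz \<open>Q\<close> the state is determined on \<open>[0, T]\<close> by the control.
\<close>

definition solution_P1 ::
  "real \<Rightarrow> (real ^ 'n) set \<Rightarrow> real ^ 'N \<Rightarrow> ('s::finite \<Rightarrow> real ^ 'N \<Rightarrow> real) \<Rightarrow>
   ('s \<Rightarrow> real ^ 'n \<Rightarrow> real) \<Rightarrow> ('s \<Rightarrow> real ^ 'N::finite \<Rightarrow> real ^ 'N) \<Rightarrow>
   (real \<Rightarrow> real ^ 'n::finite) \<Rightarrow> bool" where
  "solution_P1 T K x0 c \<phi> Q u \<longleftrightarrow>
     (\<exists>x. is_arg_min (\<lambda>(x, u). cost T c \<phi> x u) (\<lambda>(x, u). admissible T K x0 \<phi> Q x u) (x, u))"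

text \<open>
  \<open>K\<close> will be compact, hence closed, so the support of a Borel measure lies in \<open>K\<close> iff the
  complement of \<open>K\<close> is null.
\<close>

definition prob_measures_on :: "'a::topological_space set \<Rightarrow> 'a measure set" where
  "prob_measures_on K = {\<mu>. sets \<mu> = sets borel \<and> prob_space \<mu> \<and> emeasure \<mu> (- K) = 0}"

definition L_set :: "(real ^ 'n) set \<Rightarrow> ('s::finite \<Rightarrow> real ^ 'n \<Rightarrow> real) \<Rightarrow> (real ^ 's) set" where
  "L_set K \<phi> = vec_of \<phi> ` K"

definition Lambda_set ::
  "(real ^ 'n::finite) set \<Rightarrow> ('s::finite \<Rightarrow> real ^ 'n \<Rightarrow> real) \<Rightarrow> (real ^ 's) set" where
  "Lambda_set K \<phi> =
     {m. \<exists>\<mu> \<in> prob_measures_on K. \<forall>i. m $ i = (LINT v:K|\<mu>. \<phi> i v)}"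

end

theory Submission
  imports Defs "HOL-Complex_Analysis.Great_Picard"
begin

text \<open>
  The controls enter the problem only through the vector \<open>\<phi>(u(t))\<close>, on which the dynamics and the cost
  depend linearly. Let \<open>\<Lambda>\<close> be the set of moment vectors (\<open>Lambda_set\<close>); it is the convex hull of the
  compact set \<open>L = \<phi>(K)\<close>, so it is compact and convex, and every average of \<open>\<phi>(u(t))\<close> over a time interval
  belongs to it. The strategy is to pass to the limit along a minimizing sequence, which yields a state
  whose velocities are only relaxed (given by some \<open>m \<in> \<Lambda>\<close> instead of \<open>m \<in> L\<close>), and to repair this
  pointwise with the hypothesis on minimizers.

  The running cost is adjoined to the state as one more coordinate: \<open>z = (x, y)\<close> with
  \<open>y(t) = \<integral>\<^sub>0\<^sup>t c(x) \<bullet> \<phi>(u)\<close>. Linear growth bounds all states of admissible pairs uniformly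
  (\<open>admissible_states_bounded\<close>), so the extended states of a minimizing sequence are equi-Lipschitz, and by
  the Arzela-Ascoli theorem a subsequence converges uniformly to a Lipschitz function \<open>z = (x, y)\<close> for which
  \<open>y(T)\<close> is the infimum of the costs. The limit \<open>z\<close> is differentiable
  almost everywhere (\<open>lipschitz_AE_differentiable\<close>), and wherever it is, its difference quotients are
  limits of averages of velocities, so that \<open>x'(t) = Q(x(t)) m\<close> and \<open>y'(t) = c(x(t)) \<bullet> m\<close> for one
  \<open>m \<in> \<Lambda>\<close> (\<open>velocity_of_limit_in_relaxed_velocities\<close>).

  Now minimize \<open>c(x(t)) \<bullet> m'\<close> over the \<open>m' \<in> \<Lambda>\<close> with \<open>Q(x(t)) m' = x'(t)\<close>. By hypothesis the minimizer is
  \<open>\<phi>(v)\<close> for some \<open>v \<in> K\<close>, so \<open>v\<close> produces the velocity \<open>x'(t)\<close> at a cost rate of at most \<open>y'(t)\<close>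
  (\<open>control_realizing_relaxed_velocity\<close>). The admissible values \<open>v\<close> form a compact set depending on
  \<open>(x(t), z'(t))\<close> with closed graph, so \<open>u(t)\<close> can be chosen measurably
  (\<open>borel_lexicographic_selection\<close>). The pair \<open>(x, u)\<close> is admissible, and its cost is at most
  \<open>\<integral>\<^sub>0\<^sup>T y' = y(T)\<close>, the infimum. The last equality, and the passage from the almost everywhere equation
  to the integral equation throughout, is the fundamental theorem of calculus for absolutely continuous
  functions (\<open>abs_continuous_on_has_integral_derivative\<close>).
\<close>

section \<open>Almost everywhere differentiability of Lipschitz functions\<close>

text \<open>
  One half of a differentiation theorem for measures, in a form that compares two measures
  symmetrically. If \<open>\<nu> \<le> q \<mu>\<close> on \<open>A\<close>, then the points of \<open>A\<close> around which arbitrarily short intervals have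
  \<open>\<nu>\<close>-mass at least \<open>R \<mu>\<close>, with \<open>R > q\<close>, are negligible: by Vitali's theorem, disjoint such
  intervals cover those points up to a null set, and they can be kept inside an open set that exceeds \<open>A\<close> by
  \<open>\<nu>\<close>-mass at most \<open>e\<close>; if \<open>U\<close> is their union, then \<open>R \<mu>(U) \<le> \<nu>(U) \<le> q \<mu>(U) + e\<close>, which forces
  \<open>\<mu>(U) \<le> e / (R - q)\<close>.
\<close>

lemma vitali_density_null:
  fixes \<mu> \<nu> :: "real measure"
  assumes sets [simp]: "sets \<mu> = sets borel" "sets \<nu> = sets borel"
    and A: "A \<in> sets borel" "bounded A"
    and fin: "\<And>r. emeasure \<mu> (ball 0 r) < \<infinity>"
    and ac: "null_sets lborel \<subseteq> null_sets \<mu>"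
    and le: "\<And>C. C \<in> sets borel \<Longrightarrow> C \<subseteq> A \<Longrightarrow> emeasure \<nu> C \<le> ennreal q * emeasure \<mu> C"
    and outer: "\<And>e. e > 0 \<Longrightarrow> \<exists>G. open G \<and> A \<subseteq> G \<and> emeasure \<nu> (G - A) \<le> ennreal e"
    and q: "0 \<le> q" "q < R"
    and E: "E \<subseteq> A"
    and fine: "\<And>x d. x \<in> E \<Longrightarrow> d > 0 \<Longrightarrow> \<exists>a r. 0 < r \<and> r < d \<and> x \<in> cball a r \<and>
       ennreal R * emeasure \<mu> (cball a r) \<le> emeasure \<nu> (cball a r)"
  shows "\<exists>N\<in>null_sets \<mu>. E \<subseteq> N"
proof -
  obtain \<rho> where \<rho>: "A \<subseteq> ball 0 \<rho>"
    using A(2) bounded_subset_ballD by blast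
  have step: "\<exists>B. B \<in> sets borel \<and> E \<subseteq> B \<and> emeasure \<mu> B \<le> ennreal (e / (R - q))" if e: "e > 0" for e
  proof -
    obtain G where G: "open G" "A \<subseteq> G" "emeasure \<nu> (G - A) \<le> ennreal e"
      using outer[OF e] by blast
    define H where "H = G \<inter> ball 0 \<rho>"
    have H: "open H" "A \<subseteq> H" using G \<rho> by (auto simp: H_def)
    define I where "I = {(a, r). 0 < r \<and> cball a r \<subseteq> H \<and> ennreal R * emeasure \<mu> (cball a r) \<le> emeasure \<nu> (cball a r)}"
    have "\<exists>i. i \<in> I \<and> x \<in> cball (fst i) (snd i) \<and> snd i < d" if "x \<in> E" "d > 0" for x d
    proof -
      obtain \<delta> where \<delta>: "\<delta> > 0" "ball x \<delta> \<subseteq> H"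
        using H \<open>x \<in> E\<close> E by (meson openE subsetD)
      obtain a r where ar: "0 < r" "r < min d (\<delta>/2)" "x \<in> cball a r" "ennreal R * emeasure \<mu> (cball a r) \<le> emeasure \<nu> (cball a r)"
        using fine[OF \<open>x \<in> E\<close>, of "min d (\<delta>/2)"] \<delta> \<open>d > 0\<close> by auto
      have "cball a r \<subseteq> ball x \<delta>"
      proof
        fix y assume "y \<in> cball a r"
        then have "dist x y \<le> r + r"
          using ar(3) by (metis add_mono dist_commute dist_triangle_le mem_cball)
        then show "y \<in> ball x \<delta>" using ar(2) by auto
      qed
      then show ?thesis using ar \<delta> by (intro exI[of _ "(a,r)"]) (auto simp: I_def)
    qed
    note cover = this
    have pos: "\<And>i. i \<in> I \<Longrightarrow> 0 < snd i" by (auto simp: I_def)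
    have "\<exists>C. countable C \<and> C \<subseteq> I \<and>
       pairwise (\<lambda>i j. disjnt (cball (fst i) (snd i)) (cball (fst j) (snd j))) C \<and>
       negligible (E - (\<Union>i\<in>C. cball (fst i) (snd i)))"
    proof (rule Vitali_covering_theorem_cballs[of I snd E fst])
      show "0 < snd i" if "i \<in> I" for i using pos that .
      show "\<exists>i. i \<in> I \<and> x \<in> cball (fst i) (snd i) \<and> snd i < d" if "x \<in> E" "0 < d" for x d
        using cover that .
    qed blast
    then obtain C where C: "countable C" "C \<subseteq> I"
       "pairwise (\<lambda>i j. disjnt (cball (fst i) (snd i)) (cball (fst j) (snd j))) C"
       "negligible (E - (\<Union>i\<in>C. cball (fst i) (snd i)))"
      by blast
    define U where "U = (\<Union>i\<in>C. cball (fst i) (snd i))"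
    have U: "U \<in> sets borel"
      unfolding U_def by (intro sets.countable_UN' C(1)) auto
    have UH: "U \<subseteq> H"
      using C(2) unfolding U_def I_def by fastforce
    have sumeq: "emeasure M U = (\<integral>\<^sup>+ i. emeasure M (cball (fst i) (snd i)) \<partial>count_space C)" if "sets M = sets borel" for M
      unfolding U_def
      by (rule emeasure_UN_countable) (use C that in \<open>auto simp: disjoint_family_on_def pairwise_def disjnt_def\<close>)
    have "ennreal R * emeasure \<mu> U = (\<integral>\<^sup>+ i. ennreal R * emeasure \<mu> (cball (fst i) (snd i)) \<partial>count_space C)"
      by (simp add: sumeq nn_integral_cmult)
    also have "\<dots> \<le> (\<integral>\<^sup>+ i. emeasure \<nu> (cball (fst i) (snd i)) \<partial>count_space C)"
      using C(2) by (intro nn_integral_mono) (auto simp: I_def)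
    also have "\<dots> = emeasure \<nu> U" by (simp add: sumeq)
    also have "\<dots> = emeasure \<nu> (U \<inter> A) + emeasure \<nu> (U - A)"
      using U A by (subst plus_emeasure) (auto intro!: arg_cong[where f="emeasure \<nu>"])
    also have "\<dots> \<le> ennreal q * emeasure \<mu> U + ennreal e"
    proof (rule add_mono)
      have "emeasure \<nu> (U \<inter> A) \<le> ennreal q * emeasure \<mu> (U \<inter> A)"
        using U A by (intro le) auto
      also have "\<dots> \<le> ennreal q * emeasure \<mu> U"
        using U A by (intro mult_left_mono emeasure_mono) auto
      finally show "emeasure \<nu> (U \<inter> A) \<le> ennreal q * emeasure \<mu> U" .
      have "emeasure \<nu> (U - A) \<le> emeasure \<nu> (G - A)"
        using U UH A G by (intro emeasure_mono) (auto simp: H_def)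
      then show "emeasure \<nu> (U - A) \<le> ennreal e" using G(3) by simp
    qed
    finally have main: "ennreal R * emeasure \<mu> U \<le> ennreal q * emeasure \<mu> U + ennreal e" .
    have "emeasure \<mu> U \<le> emeasure \<mu> (ball 0 \<rho>)"
      using U UH by (intro emeasure_mono) (auto simp: H_def)
    then have "emeasure \<mu> U < \<infinity>" using fin[of \<rho>] by (auto simp: less_top[symmetric] top_unique)
    then obtain m where m: "emeasure \<mu> U = ennreal m" "m \<ge> 0"
      by (metis ennreal_cases infinity_ennreal_def less_irrefl)
    have "R * m \<le> q * m + e"
      using main m q e by (simp add: ennreal_mult[symmetric] ennreal_plus[symmetric] del: ennreal_plus)
    then have "m \<le> e / (R - q)" using q by (simp add: field_simps)
    then have mU: "emeasure \<mu> U \<le> ennreal (e / (R - q))" by (simp add: m ennreal_leI)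
    obtain Z where Z: "Z \<in> null_sets lborel" "E - U \<subseteq> Z"
      using C(4) unfolding U_def[symmetric] negligible_iff_null_sets
      by (meson null_sets_completion_iff2)
    then have "Z \<in> null_sets \<mu>" using ac by auto
    then have "emeasure \<mu> (U \<union> Z) = emeasure \<mu> U"
      using U by (intro emeasure_Un_null_set) auto
    then show ?thesis using Z mU U by (intro exI[of _ "U \<union> Z"]) auto
  qed
  have "\<forall>n. \<exists>B. B \<in> sets borel \<and> E \<subseteq> B \<and> emeasure \<mu> B \<le> ennreal ((1 / Suc n) / (R - q))"
    using step by (metis of_nat_0_less_iff zero_less_Suc zero_less_divide_1_iff)
  then obtain B where B: "\<And>n. B n \<in> sets borel" "\<And>n. E \<subseteq> B n" "\<And>n. emeasure \<mu> (B n) \<le> ennreal ((1 / Suc n) / (R - q))"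
    by metis
  have small: "emeasure \<mu> (\<Inter>n. B n) \<le> ennreal e" if "e > 0" for e
  proof -
    obtain n where "1 / Suc n < e * (R - q)"
      using q \<open>e > 0\<close> nat_approx_posE[of "e * (R - q)"] by auto
    then have "(1 / Suc n) / (R - q) \<le> e" using q by (subst pos_divide_le_eq) auto
    moreover have "emeasure \<mu> (\<Inter>n. B n) \<le> emeasure \<mu> (B n)"
      using B by (intro emeasure_mono) auto
    ultimately show ?thesis using B(3)[of n] by (meson ennreal_leI order_trans)
  qed
  have "emeasure \<mu> (\<Inter>n. B n) \<le> 0" by (rule ennreal_le_epsilon) (simp add: small)
  then show ?thesis using B by (intro bexI[of _ "\<Inter>n. B n"]) (auto simp: null_sets_def)
qed

text \<open>
  Such an \<open>F\<close> is a bi-Lipschitz homeomorphism of the line, so \<open>\<nu>(B) = \<lambda>(F(B))\<close> defines a measure with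
  \<open>\<nu>([a,b]) = F(b) - F(a)\<close> and with the same null sets as Lebesgue measure \<open>\<lambda>\<close>, because Lipschitz maps
  preserve null sets. Let \<open>f\<close> be its Radon-Nikodym density. Difference quotients of \<open>F\<close> are the ratios
  \<open>\<nu>(I) / \<lambda>(I)\<close>, and \<open>vitali_density_null\<close>, applied to \<open>(\<lambda>, \<nu>)\<close> where \<open>f < q\<close> and to \<open>(\<nu>, \<lambda>)\<close> where
  \<open>f > q\<close>, shows that almost everywhere they converge to \<open>f\<close>.
\<close>

lemma expanding_lipschitz_AE_differentiable:
  fixes F :: "real \<Rightarrow> real"
  assumes ex: "\<And>s t. s \<le> t \<Longrightarrow> t - s \<le> F t - F s"
    and lip: "\<And>s t. s \<le> t \<Longrightarrow> F t - F s \<le> L * (t - s)"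
  shows "\<exists>N\<in>null_sets lborel. \<forall>x. x \<notin> N \<longrightarrow> F differentiable (at x)"
proof -
  have mono: "s < t \<Longrightarrow> F s < F t" for s t using ex[of s t] by simp
  have mono_iff: "F s \<le> F t \<longleftrightarrow> s \<le> t" for s t using mono[of s t] mono[of t s] by (cases s t rule: linorder_cases) auto
  have "1 \<le> L" using ex[of 0 1] lip[of 0 1] by simp
  have Flip: "L-lipschitz_on UNIV F"
  proof (rule lipschitz_onI)
    fix s t :: real
    show "dist (F s) (F t) \<le> L * dist s t"
      using lip[of s t] lip[of t s] ex[of s t] ex[of t s] by (cases "s \<le> t") (auto simp: dist_real_def)
  qed (use \<open>1 \<le> L\<close> in auto)
  then have Fcont: "continuous_on A F" for A
    using lipschitz_on_continuous_on continuous_on_subset by blast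
  have "bij F"
  proof (rule bijI)
    show "inj F" using mono by (metis injI less_irrefl linorder_neqE_linordered_idom)
    show "surj F"
      unfolding surj_def
    proof
      fix y
      define b where "b = \<bar>y - F 0\<bar>"
      have "F (-b) \<le> y" "y \<le> F b" using ex[of 0 b] ex[of "-b" 0] by (auto simp: b_def)
      then show "\<exists>x. y = F x"
        using IVT'[of F "-b" y b] Fcont by (auto simp: b_def) 
    qed
  qed
  define G where "G = inv F"
  have GF [simp]: "G (F x) = x" "F (G y) = y" for x y
    using \<open>bij F\<close> by (simp_all add: G_def bij_is_inj bij_is_surj surj_f_inv_f)
  have Glip: "1-lipschitz_on UNIV G"
  proof (rule lipschitz_onI)
    fix s t :: real
    show "dist (G s) (G t) \<le> 1 * dist s t"
      using ex[of "G s" "G t"] ex[of "G t" "G s"] by (cases "G s \<le> G t") (auto simp: dist_real_def)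
  qed auto
  then have Gcont: "continuous_on A G" for A
    using lipschitz_on_continuous_on continuous_on_subset by blast
  have Gmeas [measurable]: "G \<in> borel_measurable borel" by (simp add: Gcont borel_measurable_continuous_onI)
  \<comment> \<open>Preimages under the inverse are images, which identifies \<open>\<nu>\<close> with \<open>B \<mapsto> \<lambda>(F(B))\<close>.\<close>
  have vim: "G -` A = F ` A" for A
    by (auto simp: image_iff) (metis GF(2))
  define \<nu> where "\<nu> = distr lborel borel G"
  have \<nu>: "emeasure \<nu> A = emeasure lborel (F ` A)" if "A \<in> sets borel" for A
    using that by (simp add: \<nu>_def emeasure_distr vim)
  have Fsets: "F ` A \<in> sets borel" if "A \<in> sets borel" for A
    using measurable_sets[OF Gmeas that] by (simp add: vim)
  have sets_\<nu> [simp]: "sets \<nu> = sets borel" by (simp add: \<nu>_def)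
  have Fimage: "F ` {a..b} = {F a..F b}" for a b
    unfolding vim[symmetric] using mono_iff by (auto) (metis GF(2) mono_iff)+
  have \<nu>_I: "emeasure \<nu> {a..b} = ennreal (F b - F a)" if "a \<le> b" for a b
    using that by (simp add: \<nu> Fimage mono_iff)
  have nullF: "negligible (F ` N)" if "negligible N" for N
  proof (rule negligible_locally_Lipschitz_image[OF _ that])
    have "norm (F y - F x) \<le> L * norm (y - x)" for x y
      using Flip by (metis UNIV_I dist_norm lipschitz_onD)
    then show "\<exists>T B. open T \<and> x \<in> T \<and> (\<forall>y\<in>N \<inter> T. norm (F y - F x) \<le> B * norm (y - x))" for x
      by (intro exI[of _ UNIV] exI[of _ L]) auto
  qed simp
  have nullG: "negligible (G ` N)" if "negligible N" for N
  proof (rule negligible_locally_Lipschitz_image[OF _ that])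
    have "norm (G y - G x) \<le> 1 * norm (y - x)" for x y
      using Glip by (metis UNIV_I dist_norm lipschitz_onD)
    then show "\<exists>T B. open T \<and> x \<in> T \<and> (\<forall>y\<in>N \<inter> T. norm (G y - G x) \<le> B * norm (y - x))" for x
      by (intro exI[of _ UNIV] exI[of _ 1]) auto
  qed simp
  have nullB: "A \<in> null_sets lborel \<longleftrightarrow> A \<in> sets borel \<and> negligible A" for A
    by (auto simp: negligible_iff_null_sets null_sets_def)
  have null: "A \<in> null_sets \<nu> \<longleftrightarrow> A \<in> null_sets lborel" if "A \<in> sets borel" for A
  proof
    assume "A \<in> null_sets \<nu>"
    then have "F ` A \<in> null_sets lborel" using that Fsets[OF that] by (auto simp: null_sets_def \<nu>)
    then have "negligible (G ` F ` A)" using nullG nullB by blast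
    then show "A \<in> null_sets lborel" using that by (simp add: nullB image_image)
  next
    assume "A \<in> null_sets lborel"
    then have "negligible (F ` A)" using nullF nullB by blast
    then have "F ` A \<in> null_sets lborel" using Fsets[OF that] by (simp add: nullB)
    then show "A \<in> null_sets \<nu>" using that by (auto simp: null_sets_def \<nu>)
  qed
  have "\<exists>f \<in> borel_measurable lborel. density lborel f = \<nu>"
    by (rule sigma_finite_measure.Radon_Nikodym[OF sigma_finite_lborel]) (auto simp: absolutely_continuous_def null nullB)
  then obtain f where [measurable]: "f \<in> borel_measurable borel" and f: "density lborel f = \<nu>"
    by auto
  have fint: "emeasure \<nu> C = (\<integral>\<^sup>+ x. f x * indicator C x \<partial>lborel)" if "C \<in> sets borel" for C
    using that by (simp add: f[symmetric] emeasure_density)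
  have lborel_outer: "\<exists>G. open G \<and> A \<subseteq> G \<and> emeasure lborel (G - A) \<le> ennreal e" if "A \<in> sets borel" "e > 0" for A :: "real set" and e
    using outer_regular_lborel_le[OF that] by metis
  have \<nu>_outer: "\<exists>G. open G \<and> A \<subseteq> G \<and> emeasure \<nu> (G - A) \<le> ennreal e" if Ae: "A \<in> sets borel" "e > 0" for A e
  proof -
    obtain U where U: "open U" "F ` A \<subseteq> U" "emeasure lborel (U - F ` A) \<le> e"
      using outer_regular_lborel_le[OF Fsets[OF Ae(1)] Ae(2)] by metis
    have op: "open (F -` U)" using U Fcont by (simp add: open_vimage)
    have "F ` (F -` U - A) = U - F ` A" unfolding vim[symmetric] by auto 
    then show ?thesis using U op Ae by (intro exI[of _ "F -` U"]) (auto simp: \<nu>)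
  qed
  have cb: "cball ((s + t) / 2) ((t - s) / 2) = {s..t}" for s t :: real
    by (auto simp: cball_eq_atLeastAtMost field_simps)
  have \<nu>_fin: "emeasure \<nu> (ball 0 r) < \<infinity>" for r
  proof -
    have "emeasure \<nu> (ball 0 r) \<le> emeasure \<nu> {-\<bar>r\<bar>..\<bar>r\<bar>}" 
      by (intro emeasure_mono) (auto)
    also have "\<dots> < \<infinity>" by (simp add: \<nu>_I)
    finally show ?thesis .
  qed
  define quo where "quo x y = (F y - F x) / (y - x)" for x y
  have quo_sym: "quo x y = quo y x" for x y
    unfolding quo_def by (metis minus_diff_eq minus_divide_divide)
  \<comment> \<open>\<open>EU x R\<close> and \<open>EL x R\<close> say that difference quotients at \<open>x\<close> at least (at most) \<open>R\<close> occur at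
    arbitrarily small scales.\<close>
  define EU where "EU x R \<longleftrightarrow> (\<forall>d>0. \<exists>y. y \<noteq> x \<and> \<bar>y - x\<bar> < d \<and> R \<le> quo x y)" for x R
  define EL where "EL x R \<longleftrightarrow> (\<forall>d>0. \<exists>y. y \<noteq> x \<and> \<bar>y - x\<bar> < d \<and> quo x y \<le> R)" for x R
  have interval: "\<exists>s t. s < t \<and> x \<in> {s..t} \<and> t - s < d \<and> P (quo s t)" 
    if Pd: "\<forall>d>0. \<exists>y. y \<noteq> x \<and> \<bar>y - x\<bar> < d \<and> P (quo x y)" "d > 0" for x d and P :: "real \<Rightarrow> bool"
  proof -
    obtain y where y: "y \<noteq> x" "\<bar>y - x\<bar> < d" "P (quo x y)" using Pd by blast
    show ?thesis
    proof (cases "x < y")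
      case True then show ?thesis using y by (intro exI[of _ x] exI[of _ y]) auto
    next
      case False then show ?thesis using y quo_sym[of x y] by (intro exI[of _ y] exI[of _ x]) auto
    qed
  qed
  have upper: "\<exists>N\<in>null_sets lborel. {x \<in> ball 0 n. f x < ennreal q \<and> EU x R} \<subseteq> N" if q: "0 \<le> q" "q < R" for q R n
  proof (rule vitali_density_null[where A="{x \<in> ball 0 n. f x < ennreal q}" and \<nu>=\<nu>])
    show "emeasure \<nu> C \<le> ennreal q * emeasure lborel C" if "C \<in> sets borel" "C \<subseteq> {x \<in> ball 0 n. f x < ennreal q}" for C
    proof -
      have "emeasure \<nu> C \<le> (\<integral>\<^sup>+ x. ennreal q * indicator C x \<partial>lborel)"
        unfolding fint[OF that(1)] using that(2)
        by (intro nn_integral_mono) (auto simp: indicator_def)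
      then show ?thesis using that by (simp add: nn_integral_cmult_indicator)
    qed
    show "\<exists>a r. 0 < r \<and> r < d \<and> x \<in> cball a r \<and> ennreal R * emeasure lborel (cball a r) \<le> emeasure \<nu> (cball a r)"
      if xd: "x \<in> {x \<in> ball 0 n. f x < ennreal q \<and> EU x R}" "d > 0" for x d
    proof -
      obtain s t where st: "s < t" "x \<in> {s..t}" "t - s < d" "R \<le> quo s t"
        using interval[of x "\<lambda>z. R \<le> z" d] xd by (auto simp: EU_def)
      have "R * (t - s) \<le> F t - F s" using st by (simp add: quo_def field_simps)
      then have "ennreal R * ennreal (t - s) \<le> ennreal (F t - F s)"
        using st q by (simp add: ennreal_mult[symmetric] ennreal_leI)
      then show ?thesis using st
        by (intro exI[of _ "(s+t)/2"] exI[of _ "(t-s)/2"]) (auto simp only: cb, auto simp: \<nu>_I)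
    qed
  qed (use q \<nu>_outer in \<open>auto intro: bounded_subset[OF bounded_ball[of 0 n]] intro: emeasure_bounded_finite[OF bounded_ball, simplified]\<close>)
  have lower: "\<exists>N\<in>null_sets \<nu>. {x \<in> ball 0 n. ennreal q < f x \<and> EL x r} \<subseteq> N" if q: "0 < r" "r < q" for q r n
  proof (rule vitali_density_null[where A="{x \<in> ball 0 n. ennreal q < f x}" and \<nu>=lborel and q = "1/q" and R="1/r"])
    show "emeasure lborel C \<le> ennreal (1/q) * emeasure \<nu> C" if "C \<in> sets borel" "C \<subseteq> {x \<in> ball 0 n. ennreal q < f x}" for C
    proof -
      have "(\<integral>\<^sup>+ x. ennreal q * indicator C x \<partial>lborel) \<le> emeasure \<nu> C"
        unfolding fint[OF that(1)] using that(2)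
        by (intro nn_integral_mono) (auto simp: indicator_def)
      then have "ennreal q * emeasure lborel C \<le> emeasure \<nu> C" using that by (simp add: nn_integral_cmult_indicator)
      then have "ennreal (1/q) * (ennreal q * emeasure lborel C) \<le> ennreal (1/q) * emeasure \<nu> C"
        by (intro mult_left_mono) auto
      then show ?thesis using q by (simp add: mult.assoc[symmetric] ennreal_mult[symmetric])
    qed
    show "\<exists>a \<rho>. 0 < \<rho> \<and> \<rho> < d \<and> x \<in> cball a \<rho> \<and> ennreal (1/r) * emeasure \<nu> (cball a \<rho>) \<le> emeasure lborel (cball a \<rho>)"
      if xd: "x \<in> {x \<in> ball 0 n. ennreal q < f x \<and> EL x r}" "d > 0" for x d
    proof -
      obtain s t where st: "s < t" "x \<in> {s..t}" "t - s < d" "quo s t \<le> r"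
        using interval[of x "\<lambda>z. z \<le> r" d] xd by (auto simp: EL_def)
      have "(1/r) * (F t - F s) \<le> t - s" using st q by (simp add: quo_def field_simps)
      then have "ennreal (1/r) * ennreal (F t - F s) \<le> ennreal (t - s)"
        using st q mono[of s t] by (simp add: ennreal_mult[symmetric] ennreal_leI del: divide_const_simps) 
      then show ?thesis using st
        by (intro exI[of _ "(s+t)/2"] exI[of _ "(t-s)/2"]) (auto simp only: cb, auto simp: \<nu>_I)
    qed
  qed (use q \<nu>_fin null nullB lborel_outer in \<open>auto intro: bounded_subset[OF bounded_ball[of 0 n]] simp: frac_less2\<close>)
  \<comment> \<open>Rational thresholds and balls of integer radius suffice, so that the union of all exceptional sets is null.\<close>
  define bad where "bad n q R = {x \<in> ball 0 (real n). f x < ennreal (of_rat q) \<and> EU x (of_rat R)} \<union>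
      {x \<in> ball 0 (real n). ennreal (of_rat R) < f x \<and> EL x (of_rat q)}" for n :: nat and q R :: rat
  have "\<exists>N\<in>null_sets lborel. 0 < q \<and> q < R \<longrightarrow> bad n q R \<subseteq> N" for n q R
  proof (cases "0 < q \<and> q < R")
    case True
    then have "(0::real) < of_rat q" "(of_rat q :: real) < of_rat R" by (auto simp: of_rat_less)
    with upper[of "of_rat q" "of_rat R" "real n"] lower[of "of_rat q" "of_rat R" "real n"]
    obtain N1 N2 where N: "N1 \<in> null_sets lborel" "N2 \<in> null_sets \<nu>"
       "{x \<in> ball 0 (real n). f x < ennreal (of_rat q) \<and> EU x (of_rat R)} \<subseteq> N1"
       "{x \<in> ball 0 (real n). ennreal (of_rat R) < f x \<and> EL x (of_rat q)} \<subseteq> N2"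
      by auto
    then have "N2 \<in> null_sets lborel" using null[of N2] by (auto simp: null_sets_def)
    with N show ?thesis by (intro bexI[of _ "N1 \<union> N2"]) (auto simp: bad_def)
  qed auto
  then have exN: "\<exists>N. N \<in> null_sets lborel \<and> (0 < q \<and> q < R \<longrightarrow> bad n q R \<subseteq> N)" for n q R by blast
  define N where "N n q R = (SOME N. N \<in> null_sets lborel \<and> (0 < q \<and> q < R \<longrightarrow> bad n q R \<subseteq> N))" for n q R
  have N: "N n q R \<in> null_sets lborel" "0 < q \<Longrightarrow> q < R \<Longrightarrow> bad n q R \<subseteq> N n q R" for n q R
    using someI_ex[OF exN[of q R n]] unfolding N_def by blast+
  define Z where "Z = (\<Union>n. \<Union>q. \<Union>R. N n q R)"
  have Z: "Z \<in> null_sets lborel" unfolding Z_def by (intro null_sets_UN N)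
  have quo_bds: "1 \<le> quo x y \<and> quo x y \<le> L" if "y \<noteq> x" for x y
    using that ex[of x y] ex[of y x] lip[of x y] lip[of y x] 
    by (cases "x < y") (auto simp: quo_def divide_simps algebra_simps)
  have "F differentiable (at x)" if "x \<notin> Z" for x
  proof -
    obtain n where n: "x \<in> ball 0 (real n)" using reals_Archimedean2[of "\<bar>x\<bar>"] by auto
    have U: "\<not> EU x (of_rat R)" if "0 < q" "q < R" "f x < ennreal (of_rat q)" for q R
      using N(2)[of q R n] \<open>x \<notin> Z\<close> that n by (auto simp: bad_def Z_def)
    have Lo: "\<not> EL x (of_rat q)" if "0 < q" "q < R" "ennreal (of_rat R) < f x" for q R
      using N(2)[of q R n] \<open>x \<notin> Z\<close> that n by (auto simp: bad_def Z_def)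
    have rat_between: "\<exists>q. a < of_rat q \<and> of_rat q < b" if "a < b" for a b :: real
      using of_rat_dense[OF that] by blast
    have "f x \<noteq> \<infinity>"
    proof
      assume inf: "f x = \<infinity>"
      obtain q where q: "L < of_rat q" "of_rat q < L + 1" using rat_between[of L "L+1"] by auto
      have "(0::real) < of_rat q" using q \<open>1 \<le> L\<close> by linarith
      then have "0 < q" by simp
      have "\<not> EL x (of_rat q)" by (rule Lo[of q "q+1"]) (use \<open>0 < q\<close> inf in auto)
      moreover have "EL x (of_rat q)" unfolding EL_def
      proof (intro allI impI)
        fix d :: real assume "d > 0"
        then show "\<exists>y. y \<noteq> x \<and> \<bar>y - x\<bar> < d \<and> quo x y \<le> real_of_rat q"
          using quo_bds[of "x + d/2" x] q by (intro exI[of _ "x + d/2"]) auto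
      qed
      ultimately show False by blast
    qed
    then obtain D where D: "f x = ennreal D" "D \<ge> 0" by (metis ennreal_cases infinity_ennreal_def)
    have "(quo x \<longlongrightarrow> D) (at x)"
    proof (rule order_tendstoI)
      fix a assume "D < a"
      then obtain q where q: "D < of_rat q" "of_rat q < a" using rat_between by blast
      then obtain R where R: "real_of_rat q < of_rat R" "of_rat R < a" using rat_between by blast
      have "\<not> EU x (of_rat R)"
        by (rule U[of q]) (use q R D in \<open>auto simp: of_rat_less ennreal_less_iff zero_less_of_rat_iff[symmetric, where 'a=real] simp del: zero_less_of_rat_iff\<close>)
      then obtain d where "d > 0" "\<And>y. y \<noteq> x \<Longrightarrow> \<bar>y - x\<bar> < d \<Longrightarrow> quo x y < of_rat R"
        by (auto simp: EU_def not_le)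
      then show "\<forall>\<^sub>F y in at x. quo x y < a"
        unfolding eventually_at using R(2) by (intro exI[of _ d]) (force simp: dist_real_def)
    next
      fix a assume "a < D"
      show "\<forall>\<^sub>F y in at x. a < quo x y"
      proof (cases "a < 0")
        case True
        have "\<forall>\<^sub>F y in at x. y \<noteq> x" by (simp add: eventually_at_filter)
        then show ?thesis by eventually_elim (use True quo_bds in \<open>fastforce\<close>)
      next
        case False
        obtain q where q: "a < of_rat q" "of_rat q < D" using rat_between[OF \<open>a < D\<close>] by blast
        then obtain R where R: "real_of_rat q < of_rat R" "of_rat R < D" using rat_between by blast
        have pos: "0 < real_of_rat q" using q False by linarith
        have "ennreal (of_rat R) < ennreal D"
        proof (rule ennreal_lessI)
          show "0 < D" using pos R by linarith
        qed (use R in auto)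
        then have "\<not> EL x (of_rat q)"
          using pos R D by (intro Lo[of q R]) (auto simp: of_rat_less)
        then obtain d where "d > 0" "\<And>y. y \<noteq> x \<Longrightarrow> \<bar>y - x\<bar> < d \<Longrightarrow> of_rat q < quo x y"
          by (auto simp: EL_def not_le)
        then show ?thesis
          unfolding eventually_at using q(1) by (intro exI[of _ d]) (force simp: dist_real_def)
      qed
    qed
    then have "(F has_field_derivative D) (at x)"
      unfolding has_field_derivative_iff by (simp add: quo_def[abs_def])
    then show ?thesis by (auto simp: real_differentiable_def)
  qed
  then show ?thesis using Z by blast
qed

text \<open>
  Adding a steep linear function makes \<open>f\<close> expanding.
\<close>

lemma lipschitz_AE_differentiable_real:
  fixes f :: "real \<Rightarrow> real"
  assumes "L-lipschitz_on UNIV f"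
  shows "\<exists>N\<in>null_sets lborel. \<forall>x. x \<notin> N \<longrightarrow> f differentiable (at x)"
proof -
  have L: "\<bar>f t - f s\<bar> \<le> L * \<bar>t - s\<bar>" for s t
    using assms by (auto simp: lipschitz_on_def dist_real_def)
  define F where "F t = f t + (L + 1) * t" for t
  have "\<exists>N\<in>null_sets lborel. \<forall>x. x \<notin> N \<longrightarrow> F differentiable (at x)"
  proof (rule expanding_lipschitz_AE_differentiable)
    fix s t :: real assume "s \<le> t"
    then show "t - s \<le> F t - F s" "F t - F s \<le> (2 * L + 1) * (t - s)"
      using L[of t s] by (auto simp: F_def algebra_simps abs_le_iff)
  qed
  then obtain N where N: "N \<in> null_sets lborel" "\<And>x. x \<notin> N \<Longrightarrow> F differentiable (at x)" by blast
  have "f differentiable (at x)" if "x \<notin> N" for x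
  proof -
    have "(\<lambda>t. F t - (L + 1) * t) differentiable (at x)"
      by (intro derivative_intros N that)
    then show ?thesis by (simp add: F_def)
  qed
  with N show ?thesis by blast
qed

theorem lipschitz_AE_differentiable:
  fixes f :: "real \<Rightarrow> 'a::euclidean_space"
  assumes lip: "L-lipschitz_on UNIV f"
  shows "\<exists>N\<in>null_sets lborel. \<forall>x. x \<notin> N \<longrightarrow> f differentiable (at x)"
proof -
  have "\<forall>b\<in>Basis. \<exists>N\<in>null_sets lborel. \<forall>x. x \<notin> N \<longrightarrow> (\<lambda>t. f t \<bullet> b) differentiable (at x)"
  proof
    fix b :: 'a assume b: "b \<in> Basis"
    have "L-lipschitz_on UNIV (\<lambda>t. f t \<bullet> b)"
    proof (rule lipschitz_onI)
      fix s t :: real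
      have "dist (f s \<bullet> b) (f t \<bullet> b) \<le> dist (f s) (f t)"
        using b by (simp add: dist_norm inner_diff_left[symmetric] Basis_le_norm)
      also have "\<dots> \<le> L * dist s t" using lip by (simp add: lipschitz_on_def)
      finally show "dist (f s \<bullet> b) (f t \<bullet> b) \<le> L * dist s t" .
    qed (use lip lipschitz_on_nonneg in auto)
    then show "\<exists>N\<in>null_sets lborel. \<forall>x. x \<notin> N \<longrightarrow> (\<lambda>t. f t \<bullet> b) differentiable (at x)"
      by (rule lipschitz_AE_differentiable_real)
  qed
  then obtain N where N: "\<And>b. b \<in> Basis \<Longrightarrow> N b \<in> null_sets lborel"
     "\<And>b x. b \<in> Basis \<Longrightarrow> x \<notin> N b \<Longrightarrow> (\<lambda>t. f t \<bullet> b) differentiable (at x)" by metis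
  have "(\<Union>b\<in>Basis. N b) \<in> null_sets lborel" using N(1) by (intro null_sets.finite_UN) auto
  moreover have "f differentiable (at x)" if "x \<notin> (\<Union>b\<in>Basis. N b)" for x
    using that N(2) by (subst differentiable_componentwise_within) auto
  ultimately show ?thesis by blast
qed

section \<open>The fundamental theorem of calculus for absolutely continuous functions\<close>

text \<open>
  The increments over a division are at most \<open>L\<close> times the total length.
\<close>

lemma lipschitz_imp_abs_continuous_on:
  fixes f :: "real \<Rightarrow> 'a::real_normed_vector"
  assumes lip: "L-lipschitz_on {a..b} f"
  shows "abs_continuous_on a b f"
  unfolding abs_continuous_on_def
proof (intro allI impI)
  fix e :: real assume "e > 0"
  have "L \<ge> 0" using lip lipschitz_on_nonneg by blast
  show "\<exists>\<delta>>0. \<forall>D. D division_of \<Union>D \<and> \<Union>D \<subseteq> {a..b} \<and> (\<Sum>I\<in>D. measure lborel I) < \<delta> \<longrightarrow>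
        (\<Sum>I\<in>D. norm (f (Sup I) - f (Inf I))) < e"
  proof (intro exI[of _ "e / (L + 1)"] conjI allI impI)
    fix D assume D: "D division_of \<Union>D \<and> \<Union>D \<subseteq> {a..b} \<and> (\<Sum>I\<in>D. measure lborel I) < e / (L + 1)"
    have "(\<Sum>I\<in>D. norm (f (Sup I) - f (Inf I))) \<le> (\<Sum>I\<in>D. L * measure lborel I)"
    proof (rule sum_mono)
      fix I assume I: "I \<in> D"
      then obtain u v where uv: "I = {u..v}" "u \<le> v"
        using division_ofD(3,4)[of D "\<Union>D" I] D by (metis atLeastatMost_empty_iff2 box_real(2))
      have "{u..v} \<subseteq> {a..b}" using uv I D by blast
      then have "u \<in> {a..b}" "v \<in> {a..b}" using uv by auto
      then have "dist (f v) (f u) \<le> L * dist v u" using lip by (auto simp: lipschitz_on_def)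
      then show "norm (f (Sup I) - f (Inf I)) \<le> L * measure lborel I"
        using uv by (simp add: dist_norm)
    qed
    also have "\<dots> = L * (\<Sum>I\<in>D. measure lborel I)" by (simp add: sum_distrib_left)
    also have "\<dots> \<le> (L + 1) * (\<Sum>I\<in>D. measure lborel I)"
      by (intro mult_right_mono sum_nonneg) auto
    also have "\<dots> < e" using D \<open>L \<ge> 0\<close> by (simp add: field_simps)
    finally show "(\<Sum>I\<in>D. norm (f (Sup I) - f (Inf I))) < e" .
  qed (use \<open>e > 0\<close> \<open>L \<ge> 0\<close> in auto)
qed

lemma abs_continuous_on_imp_continuous_on:
  fixes f :: "real \<Rightarrow> 'a::real_normed_vector"
  assumes ac: "abs_continuous_on a b f"
  shows "continuous_on {a..b} f"
  unfolding continuous_on_iff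
proof (intro ballI allI impI)
  fix s e :: real assume s: "s \<in> {a..b}" and "e > 0"
  then obtain \<delta> where \<delta>: "\<delta> > 0" "\<And>D. D division_of \<Union>D \<Longrightarrow> \<Union>D \<subseteq> {a..b} \<Longrightarrow> (\<Sum>I\<in>D. measure lborel I) < \<delta> \<Longrightarrow>
        (\<Sum>I\<in>D. norm (f (Sup I) - f (Inf I))) < e"
    using ac unfolding abs_continuous_on_def by meson
  have main: "norm (f v - f u) < e" if "u \<le> v" "u \<in> {a..b}" "v \<in> {a..b}" "v - u < \<delta>" for u v
  proof -
    have "{cbox u v} division_of cbox u v"
      using that by (intro division_of_self) auto
    then show ?thesis
      using \<delta>(2)[of "{cbox u v}"] that by auto
  qed
  show "\<exists>d>0. \<forall>t\<in>{a..b}. dist t s < d \<longrightarrow> dist (f t) (f s) < e"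
  proof (intro exI[of _ \<delta>] conjI ballI impI)
    fix t assume "t \<in> {a..b}" "dist t s < \<delta>"
    then show "dist (f t) (f s) < e"
      using main[of s t] main[of t s] s by (cases "s \<le> t") (auto simp: dist_norm norm_minus_commute)
  qed fact
qed

text \<open>
  The gauge integral makes this direct: at points where the derivative exists the gauge controls the
  linearization error, and at the points of the exceptional null set it keeps the intervals inside an
  open set \<open>G\<close> of measure less than \<open>\<delta>\<close>, where absolute continuity bounds the sum of the increments of \<open>f\<close>.
\<close>

theorem abs_continuous_on_has_integral_derivative:
  fixes f :: "real \<Rightarrow> 'a::banach"
  assumes ab: "a \<le> b" and ac: "abs_continuous_on a b f" and N: "negligible N"
    and der: "\<And>x. x \<in> {a<..<b} - N \<Longrightarrow> (f has_vector_derivative g x) (at x)"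
  shows "(g has_integral f b - f a) {a..b}"
proof -
  define M where "M = N \<union> {a, b}"
  have M: "negligible M" using N by (simp add: M_def negligible_Un negligible_insert)
  define h where "h x = (if x \<in> M then 0 else g x)" for x
  have "(h has_integral f b - f a) {a..b}"
    unfolding has_integral_real
  proof (intro allI impI)
    fix e :: real assume e: "e > 0"
    define \<eta> where "\<eta> = e / (2 * (b - a + 1))"
    have \<eta>: "\<eta> > 0" "\<eta> * (b - a) < e / 2" using e ab by (auto simp: \<eta>_def field_simps)
    obtain \<delta> where \<delta>: "\<delta> > 0" "\<And>D. D division_of \<Union>D \<Longrightarrow> \<Union>D \<subseteq> {a..b} \<Longrightarrow> (\<Sum>I\<in>D. measure lborel I) < \<delta> \<Longrightarrow>
        (\<Sum>I\<in>D. norm (f (Sup I) - f (Inf I))) < e / 2"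
      using ac half_gt_zero[OF e] unfolding abs_continuous_on_def by meson
    have Mset: "M \<in> sets lebesgue" using M negligible_imp_sets by blast
    obtain G where G: "open G" "M \<subseteq> G" "G - M \<in> lmeasurable" "emeasure lebesgue (G - M) < ennreal \<delta>"
      using sets_lebesgue_outer_open[OF Mset \<delta>(1)] by metis
    have Gl: "G \<in> lmeasurable" using G M
      by (metis measurable_Diff_null_set negligible_iff_null_sets borel_open sets_completionI_sets sets_lborel)
    have "emeasure lebesgue (G - M) = emeasure lebesgue G"
      using M G by (intro emeasure_Diff_null_set) (auto simp: negligible_iff_null_sets)
    then have Gm: "measure lebesgue G < \<delta>"
      using G(4) Gl by (simp add: emeasure_eq_measure2 ennreal_less_iff)
    have "\<forall>x. \<exists>d>0. x \<in> {a<..<b} - N \<longrightarrow>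
         (\<forall>y. norm (y-x) < d \<longrightarrow> norm (f y - f x - (y-x) *\<^sub>R g x) \<le> \<eta> * norm (y-x))"
      using der[unfolded has_vector_derivative_def has_derivative_at_alt] \<eta>(1) by (metis zero_less_one)
    then obtain d where d: "\<And>x. d x > 0" "\<And>x y. x \<in> {a<..<b} - N \<Longrightarrow> norm (y-x) < d x \<Longrightarrow>
         norm (f y - f x - (y-x) *\<^sub>R g x) \<le> \<eta> * norm (y-x)"
      by metis
    define \<gamma> where "\<gamma> x = (if x \<in> M then G else ball x (d x))" for x
    show "\<exists>\<gamma>. gauge \<gamma> \<and> (\<forall>D. D tagged_division_of {a..b} \<and> \<gamma> fine D \<longrightarrow>
        norm ((\<Sum>(x, k)\<in>D. measure lborel k *\<^sub>R h x) - (f b - f a)) < e)"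
    proof (intro exI[of _ \<gamma>] conjI allI impI)
      show "gauge \<gamma>" using G d(1) by (auto simp: gauge_def \<gamma>_def)
    next
      fix D assume "D tagged_division_of {a..b} \<and> \<gamma> fine D"
      then have D: "D tagged_division_of {a..b}" and fine: "\<gamma> fine D" by auto
      have fin: "finite D" using D by blast
      define t where "t = (\<lambda>(x, K). measure lborel K *\<^sub>R h x - (f (Sup K) - f (Inf K)))"
      define D1 where "D1 = {p \<in> D. fst p \<in> M}"
      define D2 where "D2 = {p \<in> D. fst p \<notin> M}"
      have Dsplit: "D = D1 \<union> D2" "D1 \<inter> D2 = {}" "finite D1" "finite D2"
        using fin by (auto simp: D1_def D2_def)
      have "(\<Sum>(x, k)\<in>D. measure lborel k *\<^sub>R h x) - (f b - f a) = sum t D"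
        unfolding additive_tagged_division_1[OF ab D, of f, symmetric] t_def
        by (simp add: sum_subtractf split_def)
      also have "\<dots> = sum t D1 + sum t D2"
        using Dsplit by (metis sum.union_disjoint)
      finally have eq: "(\<Sum>(x, k)\<in>D. measure lborel k *\<^sub>R h x) - (f b - f a) = sum t D1 + sum t D2" .
      have interval: "\<exists>u v. K = {u..v} \<and> u \<le> v \<and> x \<in> {u..v} \<and> {u..v} \<subseteq> {a..b} \<and> {u..v} \<subseteq> \<gamma> x" if xK: "(x, K) \<in> D" for x K
      proof -
        have "x \<in> K" "K \<subseteq> {a..b}" "\<exists>u v. K = cbox u v" "K \<subseteq> \<gamma> x"
          using tagged_division_ofD(2-4)[OF D xK] fineD[OF fine xK] by auto
        then show ?thesis by (metis atLeastAtMost_iff box_real(2) order_trans)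
      qed
      have "norm (sum t D2) \<le> (\<Sum>p\<in>D2. \<eta> * measure lborel (snd p))"
      proof (rule sum_norm_le)
        fix p assume p: "p \<in> D2"
        obtain x K where xK: "p = (x, K)" by force
        then have x: "x \<notin> M" "(x, K) \<in> D" using p by (auto simp: D2_def)
        then obtain u v where uv: "K = {u..v}" "u \<le> v" "x \<in> {u..v}" "{u..v} \<subseteq> {a..b}" "{u..v} \<subseteq> ball x (d x)"
          using interval[of x K] by (auto simp: \<gamma>_def)
        have xx: "x \<in> {a<..<b} - N" using x uv by (auto simp: M_def less_le)
        have "u \<in> ball x (d x)" "v \<in> ball x (d x)" using uv(2) by (auto intro!: subsetD[OF uv(5)] simp del: mem_ball)
        then have "norm (u - x) < d x" "norm (v - x) < d x"
          by (auto simp: dist_real_def abs_minus_commute)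
        then have "norm (f u - f x - (u-x) *\<^sub>R g x) \<le> \<eta> * norm (u-x)"
           "norm (f v - f x - (v-x) *\<^sub>R g x) \<le> \<eta> * norm (v-x)"
          using d(2)[OF xx] by blast+
        moreover have "t p = (f u - f x - (u-x) *\<^sub>R g x) - (f v - f x - (v-x) *\<^sub>R g x)"
          using uv x xK by (simp add: t_def h_def algebra_simps)
        ultimately have "norm (t p) \<le> \<eta> * norm (u-x) + \<eta> * norm (v-x)"
          by (metis add_mono norm_triangle_ineq4 order_trans)
        also have "\<dots> = \<eta> * measure lborel K" using uv by (auto simp: algebra_simps)
        finally show "norm (t p) \<le> \<eta> * measure lborel (snd p)" by (simp add: xK)
      qed
      also have "\<dots> \<le> (\<Sum>p\<in>D. \<eta> * measure lborel (snd p))"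
        using fin \<eta> by (intro sum_mono2) (auto simp: D2_def)
      also have "\<dots> = \<eta> * (b - a)"
        using additive_content_tagged_division[of D a b] D ab
        by (simp add: sum_distrib_left[symmetric] split_def)
      finally have n2: "norm (sum t D2) < e / 2" using \<eta>(2) by simp
      have part: "D1 tagged_partial_division_of {a..b}"
        using D by (auto simp: D1_def tagged_division_of_def intro: tagged_partial_division_subset)
      then have D1: "D1 tagged_division_of \<Union>(snd ` D1)"
        by (rule tagged_partial_division_of_Union_self)
      have div: "snd ` D1 division_of \<Union>(snd ` D1)"
        by (rule division_of_tagged_division[OF D1])
      have sub: "\<Union>(snd ` D1) \<subseteq> {a..b}" "\<Union>(snd ` D1) \<subseteq> G"
        using interval by (force simp: D1_def \<gamma>_def)+
      have "(\<Sum>I\<in>snd ` D1. measure lborel I) = (\<Sum>I\<in>snd ` D1. measure lebesgue I)"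
        using division_ofD(4)[OF div] by (intro sum.cong refl) fastforce
      also have "\<dots> = measure lebesgue (\<Union>(snd ` D1))" by (rule content_division[OF div])
      also have "\<dots> \<le> measure lebesgue G"
        using sub Gl lmeasurable_division[OF div] by (intro measure_mono_fmeasurable) auto
      finally have small: "(\<Sum>I\<in>snd ` D1. norm (f (Sup I) - f (Inf I))) < e / 2"
        using \<delta>(2)[OF div sub(1)] Gm by simp
      \<comment> \<open>The sum over tagged intervals becomes a sum over intervals only for a summand vanishing on degenerate
        intervals. These include the empty \<open>cbox u v\<close> with \<open>v < u\<close>, for which \<open>Sup\<close> and \<open>Inf\<close> have no useful value.\<close>
      define w where "w I = (if I = {} then 0 else norm (f (Sup I) - f (Inf I)))" for I
      have w: "w (cbox u v) = 0" if "box u v = {}" for u v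
        using that by (cases "u = v") (auto simp: w_def)
      have "norm (sum t D1) \<le> (\<Sum>p\<in>D1. w (snd p))"
      proof (rule sum_norm_le)
        fix p assume p: "p \<in> D1"
        obtain x K where xK: "p = (x, K)" by force
        then have "x \<in> M" "(x, K) \<in> D" using p by (auto simp: D1_def)
        then show "norm (t p) \<le> w (snd p)"
          using interval[of x K] by (auto simp: xK t_def w_def h_def norm_minus_commute)
      qed
      also have "\<dots> = (\<Sum>I\<in>snd ` D1. w I)"
        using sum.over_tagged_division_lemma[OF D1, of w] w by (simp add: split_def)
      also have "\<dots> \<le> (\<Sum>I\<in>snd ` D1. norm (f (Sup I) - f (Inf I)))"
        by (intro sum_mono) (auto simp: w_def)
      finally have n1: "norm (sum t D1) < e / 2" using small by simp
      show "norm ((\<Sum>(x, k)\<in>D. measure lborel k *\<^sub>R h x) - (f b - f a)) < e"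
        unfolding eq using n1 n2 norm_triangle_ineq[of "sum t D1" "sum t D2"] by simp
    qed
  qed
  then show ?thesis
    by (rule has_integral_spike[OF M, rotated]) (simp add: h_def)
qed

section \<open>Moment vectors of probability measures\<close>

lemma continuous_on_vec_of:
  assumes "\<And>i. continuous_on S (f i)"
  shows "continuous_on S (vec_of f)"
  unfolding vec_of_def[abs_def] by (intro continuous_on_vec_lambda assms)

lemma integrable_on_compact_prob:
  fixes f :: "'a::euclidean_space \<Rightarrow> real"
  assumes "finite_measure \<mu>" "sets \<mu> = sets borel" and K: "compact K" and f: "continuous_on UNIV f"
  shows "integrable \<mu> (\<lambda>v. indicator K v *\<^sub>R f v)"
proof -
  interpret finite_measure \<mu> by fact
  have m: "(\<lambda>v. indicator K v *\<^sub>R f v) \<in> borel_measurable \<mu>"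
    using assms(2) borel_measurable_continuous_onI[OF f] compact_imp_closed[OF K]
    by (simp cong: measurable_cong_sets)
  have "bounded (f ` K)"
    by (intro compact_imp_bounded compact_continuous_image K continuous_on_subset[OF f]) auto
  then obtain B where "\<And>v. v \<in> K \<Longrightarrow> \<bar>f v\<bar> \<le> B" by (auto simp: bounded_iff)
  then have "\<bar>indicator K v *\<^sub>R f v\<bar> \<le> \<bar>B\<bar>" for v by (force simp: indicator_def)
  then show ?thesis by (intro integrable_const_bound[OF _ m, of "\<bar>B\<bar>"]) auto
qed

text \<open>
  A barycenter lies in the closed convex hull because a separating hyperplane could be integrated
  against the measure; conversely a convex combination of points \<open>\<phi>(v)\<close> is the moment vector of a finitely
  supported measure. For compact \<open>K\<close> the hull is already closed.
\<close>

lemma Lambda_set_eq_convex_hull: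
  fixes K :: "(real ^ 'n::finite) set" and \<phi> :: "'s::finite \<Rightarrow> real ^ 'n \<Rightarrow> real"
  assumes K: "compact K" and \<phi>: "\<And>i. continuous_on UNIV (\<phi> i)"
  shows "Lambda_set K \<phi> = convex hull (L_set K \<phi>)"
proof
  have comp: "compact (convex hull (L_set K \<phi>))"
    unfolding L_set_def
    by (intro compact_convex_hull compact_continuous_image K continuous_on_vec_of continuous_on_subset[OF \<phi>]) auto
  show "Lambda_set K \<phi> \<subseteq> convex hull (L_set K \<phi>)"
  proof
    fix m assume "m \<in> Lambda_set K \<phi>"
    then obtain \<mu> where \<mu>: "sets \<mu> = sets borel" "prob_space \<mu>" "emeasure \<mu> (- K) = 0"
      and m: "\<And>i. m $ i = (LINT v:K|\<mu>. \<phi> i v)"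
      by (auto simp: Lambda_set_def prob_measures_on_def)
    interpret prob_space \<mu> by fact
    have int: "integrable \<mu> (\<lambda>v. indicator K v *\<^sub>R \<phi> i v)" for i
      by (rule integrable_on_compact_prob[OF finite_measure_axioms \<mu>(1) K \<phi>])
    have K_sets: "K \<in> sets \<mu>" using \<mu>(1) compact_imp_closed[OF K] by simp
    have AE: "AE v in \<mu>. v \<in> K"
      using \<mu>(1,3) K_sets by (intro AE_I[where N="- K"]) auto
    show "m \<in> convex hull (L_set K \<phi>)"
    proof (rule ccontr)
      assume "m \<notin> convex hull (L_set K \<phi>)"
      then obtain a b where ab: "a \<bullet> m < b" "\<And>x. x \<in> convex hull (L_set K \<phi>) \<Longrightarrow> a \<bullet> x > b"
        using separating_hyperplane_closed_point[of "convex hull (L_set K \<phi>)" m] compact_imp_closed[OF comp] convex_convex_hull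
        by blast
      have "b = (\<integral>v. b \<partial>\<mu>)" by (simp add: prob_space)
      also have "\<dots> \<le> (\<integral>v. (\<Sum>i\<in>UNIV. a $ i * (indicator K v *\<^sub>R \<phi> i v)) \<partial>\<mu>)"
      proof (rule integral_mono_AE)
        show "AE v in \<mu>. b \<le> (\<Sum>i\<in>UNIV. a $ i * (indicator K v *\<^sub>R \<phi> i v))"
          using AE
        proof eventually_elim
          case (elim v)
          then have "vec_of \<phi> v \<in> convex hull (L_set K \<phi>)" by (auto simp: L_set_def hull_inc)
          then have "a \<bullet> vec_of \<phi> v > b" by (rule ab)
          then show ?case using elim by (simp add: inner_vec_def vec_of_def)
        qed
        show "integrable \<mu> (\<lambda>v. \<Sum>i\<in>UNIV. a $ i * (indicator K v *\<^sub>R \<phi> i v))"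
          by (intro Bochner_Integration.integrable_sum integrable_mult_right int)
      qed simp
      also have "\<dots> = (\<Sum>i\<in>UNIV. a $ i * m $ i)"
        unfolding m set_lebesgue_integral_def
        by (subst Bochner_Integration.integral_sum[OF integrable_mult_right[OF int]]) simp
      also have "\<dots> = a \<bullet> m" by (simp add: inner_vec_def)
      finally show False using ab(1) by simp
    qed
  qed
  show "convex hull (L_set K \<phi>) \<subseteq> Lambda_set K \<phi>"
  proof
    fix m assume "m \<in> convex hull (L_set K \<phi>)"
    then obtain S w where S: "finite S" "S \<subseteq> L_set K \<phi>" and w: "\<And>x. x \<in> S \<Longrightarrow> 0 \<le> w x" "sum w S = 1"
      and m: "(\<Sum>x\<in>S. w x *\<^sub>R x) = m"
      by (auto simp: convex_hull_explicit)
    have "\<forall>x\<in>S. \<exists>v\<in>K. vec_of \<phi> v = x" using S(2) by (auto simp: L_set_def)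
    then obtain g where g: "\<And>x. x \<in> S \<Longrightarrow> g x \<in> K" "\<And>x. x \<in> S \<Longrightarrow> vec_of \<phi> (g x) = x" by metis
    define P where "P = point_measure S (\<lambda>x. ennreal (w x))"
    have Pm: "h \<in> measurable P borel" for h :: "_ \<Rightarrow> 'x::topological_space" by (simp add: P_def)
    have Kb: "K \<in> sets borel" using compact_imp_closed[OF K] by simp
    have P1: "emeasure P S = 1"
      using S(1) w by (simp add: P_def emeasure_point_measure_finite sum_ennreal[symmetric] del: sum_ennreal) (simp add: sum_ennreal)
    define \<mu> where "\<mu> = distr P borel g"
    have "\<mu> \<in> prob_measures_on K"
      unfolding prob_measures_on_def
    proof (intro CollectI conjI)
      show "sets \<mu> = sets borel" by (simp add: \<mu>_def)
      have "prob_space P" by (rule prob_spaceI) (use P1 in \<open>simp add: P_def space_point_measure\<close>)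
      then show "prob_space \<mu>" unfolding \<mu>_def by (rule prob_space.prob_space_distr[OF _ Pm])
      have "g -` (- K) \<inter> S = {}" using g by auto
      then show "emeasure \<mu> (- K) = 0" using Kb unfolding \<mu>_def
        by (subst emeasure_distr) (auto simp: Pm P_def space_point_measure)
    qed
    moreover have "m $ i = (LINT v:K|\<mu>. \<phi> i v)" for i
    proof -
      have "(LINT v:K|\<mu>. \<phi> i v) = (\<integral>x. indicator K (g x) *\<^sub>R \<phi> i (g x) \<partial>P)"
        unfolding set_lebesgue_integral_def \<mu>_def
        using borel_measurable_continuous_onI[OF \<phi>[of i]] Kb
        by (subst integral_distr) (auto simp: Pm)
      also have "\<dots> = (\<Sum>x\<in>S. w x *\<^sub>R (indicator K (g x) *\<^sub>R \<phi> i (g x)))"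
        unfolding P_def using S(1) w(1) by (subst lebesgue_integral_point_measure_finite) auto
      also have "\<dots> = (\<Sum>x\<in>S. w x * x $ i)"
      proof (rule sum.cong[OF refl])
        fix x assume xS: "x \<in> S"
        then have "vec_of \<phi> (g x) $ i = x $ i" using g(2) by simp
          then have "\<phi> i (g x) = x $ i" by (simp add: vec_of_def)
        then show "w x *\<^sub>R (indicator K (g x) *\<^sub>R \<phi> i (g x)) = w x * x $ i" using g(1)[OF xS] by simp
      qed
      also have "\<dots> = m $ i" unfolding m[symmetric] by simp
      finally show ?thesis by simp
    qed
    ultimately show "m \<in> Lambda_set K \<phi>" by (auto simp: Lambda_set_def)
  qed
qed

lemma compact_Lambda_set:
  fixes K :: "(real ^ 'n::finite) set" and \<phi> :: "'s::finite \<Rightarrow> real ^ 'n \<Rightarrow> real"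
  assumes K: "compact K" and \<phi>: "\<And>i. continuous_on UNIV (\<phi> i)"
  shows "compact (Lambda_set K \<phi>)"
  unfolding Lambda_set_eq_convex_hull[OF assms] L_set_def
  by (intro compact_convex_hull compact_continuous_image K continuous_on_vec_of continuous_on_subset[OF \<phi>]) auto

text \<open>
  The measure in the definition of \<open>\<Lambda>\<close> is the distribution of \<open>u\<close>.
\<close>

lemma expectation_in_Lambda_set:
  fixes K :: "(real ^ 'n::finite) set" and \<phi> :: "'s::finite \<Rightarrow> real ^ 'n \<Rightarrow> real"
  assumes K: "compact K" and \<phi>: "\<And>i. continuous_on UNIV (\<phi> i)"
    and M: "prob_space M" and u: "u \<in> borel_measurable M" and AE: "AE x in M. u x \<in> K"
  shows "(\<chi> i. \<integral>x. \<phi> i (u x) \<partial>M) \<in> Lambda_set K \<phi>"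
proof -
  interpret prob_space M by fact
  have Kb: "K \<in> sets borel" using compact_imp_closed[OF K] by simp
  define \<mu> where "\<mu> = distr M borel u"
  have "\<mu> \<in> prob_measures_on K"
    unfolding prob_measures_on_def
  proof (intro CollectI conjI)
    show "sets \<mu> = sets borel" by (simp add: \<mu>_def)
    show "prob_space \<mu>" unfolding \<mu>_def by (rule prob_space_distr[OF u])
    have "emeasure M (u -` (- K) \<inter> space M) = 0"
      using AE u Kb by (subst AE_iff_measurable[symmetric, where P="\<lambda>x. u x \<in> K"]) (auto intro: measurable_sets)
    then show "emeasure \<mu> (- K) = 0" unfolding \<mu>_def using Kb u by (subst emeasure_distr) auto
  qed
  moreover have "(LINT v:K|\<mu>. \<phi> i v) = (\<integral>x. \<phi> i (u x) \<partial>M)" for i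
  proof -
    have b: "\<phi> i \<in> borel_measurable borel" using \<phi> borel_measurable_continuous_onI by blast
    have "(LINT v:K|\<mu>. \<phi> i v) = (\<integral>x. indicator K (u x) *\<^sub>R \<phi> i (u x) \<partial>M)"
      unfolding set_lebesgue_integral_def \<mu>_def
      using b Kb u by (subst integral_distr) auto
    also have "\<dots> = (\<integral>x. \<phi> i (u x) \<partial>M)"
    proof (rule integral_cong_AE)
      show "(\<lambda>x. indicator K (u x) *\<^sub>R \<phi> i (u x)) \<in> borel_measurable M"
        using b Kb u by measurable
      show "(\<lambda>x. \<phi> i (u x)) \<in> borel_measurable M" using b u by measurable
      show "AE x in M. indicator K (u x) *\<^sub>R \<phi> i (u x) = \<phi> i (u x)" using AE by eventually_elim simp
    qed
    finally show ?thesis .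
  qed
  ultimately show ?thesis unfolding Lambda_set_def by (intro CollectI bexI[of _ \<mu>]) auto
qed

text \<open>
  This is how convexity enters the limit argument: averaging over time is an expectation under the uniform
  distribution.
\<close>

lemma average_in_Lambda_set:
  fixes K :: "(real ^ 'n::finite) set" and \<phi> :: "'s::finite \<Rightarrow> real ^ 'n \<Rightarrow> real"
  assumes K: "compact K" and \<phi>: "\<And>i. continuous_on UNIV (\<phi> i)"
    and ab: "a < b" and u: "u \<in> borel_measurable (lebesgue_on {a..b})"
    and AE: "AE t in lebesgue_on {a..b}. u t \<in> K"
  shows "(\<chi> i. (\<integral>t. \<phi> i (u t) \<partial>lebesgue_on {a..b}) / (b - a)) \<in> Lambda_set K \<phi>"
proof -
  define M where "M = density (lebesgue_on {a..b}) (\<lambda>_. ennreal (1 / (b - a)))"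
  have "prob_space M"
  proof (rule prob_spaceI)
    have "emeasure M (space M) = ennreal (1 / (b - a)) * emeasure (lebesgue_on {a..b}) {a..b}"
      unfolding M_def by (subst emeasure_density) (auto simp: nn_integral_cmult_indicator)
    also have "emeasure (lebesgue_on {a..b}) {a..b} = ennreal (b - a)"
      using ab by (simp add: emeasure_restrict_space)
    also have "ennreal (1 / (b - a)) * ennreal (b - a) = 1"
      using ab by (simp add: ennreal_mult[symmetric])
    finally show "emeasure M (space M) = 1" .
  qed
  moreover have "u \<in> borel_measurable M" using u by (simp add: M_def)
  moreover have "AE t in M. u t \<in> K" unfolding M_def
    using AE by (subst AE_density) auto
  ultimately have "(\<chi> i. \<integral>t. \<phi> i (u t) \<partial>M) \<in> Lambda_set K \<phi>"
    by (intro expectation_in_Lambda_set K \<phi>)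
  moreover have "(\<integral>t. \<phi> i (u t) \<partial>M) = (\<integral>t. \<phi> i (u t) \<partial>lebesgue_on {a..b}) / (b - a)" for i
  proof -
    have "\<phi> i \<in> borel_measurable borel" using \<phi> borel_measurable_continuous_onI by blast
    then have "(\<lambda>t. \<phi> i (u t)) \<in> borel_measurable (lebesgue_on {a..b})" using u by measurable
    then have "(\<integral>t. \<phi> i (u t) \<partial>M) = (\<integral>t. (1 / (b - a)) *\<^sub>R \<phi> i (u t) \<partial>lebesgue_on {a..b})"
      unfolding M_def using ab by (subst integral_density) auto
    then show ?thesis by (simp add: integral_mult_right_zero)
  qed
  ultimately show ?thesis by simp
qed

section \<open>Measurable selection from compact sections\<close>

text \<open>
  The selection is the lexicographically smallest point of the section, with respect to an enumeration of the
  basis. Fixing the coordinates one at a time, the minimum \<open>\<tau>(p)\<close> of the next coordinate is a Borel function of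
  \<open>p\<close>: the condition \<open>\<tau>(p) \<le> \<alpha>\<close> says that \<open>(p, \<sigma>(p))\<close> lies in the projection along \<open>K\<close> of a closed set,
  where \<open>\<sigma>\<close> carries the coordinates already fixed, and projections along compact sets are closed.
\<close>

lemma borel_lexicographic_selection:
  fixes R :: "('p::euclidean_space \<times> 'e::euclidean_space) set"
  assumes R: "closed R" and K: "compact K"
  shows "\<exists>\<sigma>\<in>borel_measurable borel. \<forall>p. (\<exists>u\<in>K. (p, u) \<in> R) \<longrightarrow> \<sigma> p \<in> K \<and> (p, \<sigma> p) \<in> R"
proof -
  define D where "D = {p. \<exists>u\<in>K. (p, u) \<in> R}"
  have swap: "closed {(u, p). (p, u) \<in> R}"
  proof -
    have "{(u, p). (p, u) \<in> R} = prod.swap -` R" by auto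
    then show ?thesis using closed_vimage[OF R continuous_on_swap] by simp
  qed
  have D: "closed D"
    using closed_compact_projection[OF K swap] by (simp add: D_def Bex_def)
  have "finite B \<Longrightarrow> B \<subseteq> Basis \<Longrightarrow> \<exists>\<sigma>\<in>borel_measurable borel. \<forall>p\<in>D. \<exists>u\<in>K. (p, u) \<in> R \<and> (\<forall>b\<in>B. u \<bullet> b = \<sigma> p \<bullet> b)" for B
  proof (induction B rule: finite_induct)
    case empty
    show ?case by (intro bexI[of _ "\<lambda>_. 0"]) (auto simp: D_def)
  next
    case (insert b B)
    then obtain \<sigma> where [measurable]: "\<sigma> \<in> borel_measurable borel"
      and \<sigma>: "\<And>p. p \<in> D \<Longrightarrow> \<exists>u\<in>K. (p, u) \<in> R \<and> (\<forall>b\<in>B. u \<bullet> b = \<sigma> p \<bullet> b)" by auto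
    define S where "S p = {u\<in>K. (p, u) \<in> R \<and> (\<forall>b'\<in>B. u \<bullet> b' = \<sigma> p \<bullet> b')}" for p
    define \<tau> where "\<tau> p = (if p \<in> D then Inf ((\<lambda>u. u \<bullet> b) ` S p) else 0)" for p
    have S_ne: "S p \<noteq> {}" if "p \<in> D" for p using \<sigma>[OF that] by (auto simp: S_def)
    have S_compact: "compact (S p)" for p
    proof -
      have "closed (Pair p -` R)"
        by (intro closed_vimage R continuous_intros)
      moreover have "closed {u. u \<bullet> b' = \<sigma> p \<bullet> b'}" for b'
        by (intro closed_Collect_eq continuous_intros)
      ultimately have "compact (K \<inter> (Pair p -` R \<inter> (\<Inter>b'\<in>B. {u. u \<bullet> b' = \<sigma> p \<bullet> b'})))"
        by (intro compact_Int_closed K closed_Int closed_INT) auto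
      moreover have "S p = K \<inter> (Pair p -` R \<inter> (\<Inter>b'\<in>B. {u. u \<bullet> b' = \<sigma> p \<bullet> b'}))"
        by (auto simp: S_def)
      ultimately show ?thesis by simp
    qed
    have img: "compact ((\<lambda>u. u \<bullet> b) ` S p)" for p
      by (intro compact_continuous_image S_compact continuous_intros)
    have \<tau>_att: "\<exists>u\<in>S p. u \<bullet> b = \<tau> p" if "p \<in> D" for p
    proof -
      have "Inf ((\<lambda>u. u \<bullet> b) ` S p) \<in> (\<lambda>u. u \<bullet> b) ` S p"
        using img[of p] S_ne[OF that]
        by (intro closed_contains_Inf) (auto intro: compact_imp_closed bounded_imp_bdd_below compact_imp_bounded)
      then show ?thesis using that by (auto simp: \<tau>_def)
    qed
    have \<tau>_le: "\<tau> p \<le> u \<bullet> b" if "p \<in> D" "u \<in> S p" for p u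
      using that img[of p]
      by (auto simp: \<tau>_def intro!: cInf_lower bounded_imp_bdd_below compact_imp_bounded)
    have [measurable]: "\<tau> \<in> borel_measurable borel"
      unfolding borel_measurable_iff_le
    proof
      fix \<alpha> :: real
      define C where "C = {q. \<exists>u. u \<in> K \<and> (u, q) \<in> {(u, p, w). (p, u) \<in> R \<and> (\<forall>b'\<in>B. u \<bullet> b' = w \<bullet> b') \<and> u \<bullet> b \<le> \<alpha>}}"
      have "closed C"
        unfolding C_def
      proof (rule closed_compact_projection[OF K])
        have "closed ((\<lambda>z. (fst (snd z), fst z)) -` R :: ('e \<times> 'p \<times> 'e) set)"
          by (intro closed_vimage R continuous_intros)
        moreover have "closed {z :: 'e \<times> 'p \<times> 'e. fst z \<bullet> b' = snd (snd z) \<bullet> b'}" for b'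
          by (intro closed_Collect_eq continuous_intros)
        moreover have "closed {z :: 'e \<times> 'p \<times> 'e. fst z \<bullet> b \<le> \<alpha>}"
          by (intro closed_Collect_le continuous_intros)
        ultimately have "closed ((\<lambda>z. (fst (snd z), fst z)) -` R \<inter> (\<Inter>b'\<in>B. {z :: 'e \<times> 'p \<times> 'e. fst z \<bullet> b' = snd (snd z) \<bullet> b'}) \<inter> {z. fst z \<bullet> b \<le> \<alpha>})"
          by (intro closed_Int closed_INT) auto
        moreover have "{(u, p, w). (p, u) \<in> R \<and> (\<forall>b'\<in>B. u \<bullet> b' = w \<bullet> b') \<and> u \<bullet> b \<le> \<alpha>} =
           (\<lambda>z. (fst (snd z), fst z)) -` R \<inter> (\<Inter>b'\<in>B. {z. fst z \<bullet> b' = snd (snd z) \<bullet> b'}) \<inter> {z. fst z \<bullet> b \<le> \<alpha>}"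
          by auto
        ultimately show "closed {(u, p, w). (p, u) \<in> R \<and> (\<forall>b'\<in>B. u \<bullet> b' = w \<bullet> b') \<and> u \<bullet> b \<le> \<alpha>}"
          by simp
      qed
      then have C: "C \<in> sets borel" by simp
      have inC: "(p, \<sigma> p) \<in> C \<longleftrightarrow> p \<in> D \<and> \<tau> p \<le> \<alpha>" for p
      proof
        assume "(p, \<sigma> p) \<in> C"
        then obtain u where u: "u \<in> S p" "u \<bullet> b \<le> \<alpha>" by (auto simp: C_def S_def)
        then have "p \<in> D" by (auto simp: S_def D_def)
        then show "p \<in> D \<and> \<tau> p \<le> \<alpha>" using \<tau>_le[of p u] u by auto
      next
        assume "p \<in> D \<and> \<tau> p \<le> \<alpha>"
        then show "(p, \<sigma> p) \<in> C" using \<tau>_att[of p] by (force simp: C_def S_def)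
      qed
      have "(\<lambda>p. (p, \<sigma> p)) -` C \<inter> space borel \<in> sets borel"
        by (rule measurable_sets[OF _ C]) (simp add: borel_prod[symmetric])
      moreover have "{p. \<tau> p \<le> \<alpha>} = ((\<lambda>p. (p, \<sigma> p)) -` C \<inter> space borel) \<union> (if 0 \<le> \<alpha> then - D else {})"
        using inC by (auto simp: \<tau>_def)
      ultimately show "{w \<in> space borel. \<tau> w \<le> \<alpha>} \<in> sets borel"
        using D by auto
    qed
    define \<sigma>' where "\<sigma>' p = \<sigma> p + (\<tau> p - \<sigma> p \<bullet> b) *\<^sub>R b" for p
    have "\<sigma>' \<in> borel_measurable borel" unfolding \<sigma>'_def[abs_def] by measurable
    moreover have "\<exists>u\<in>K. (p, u) \<in> R \<and> (\<forall>b'\<in>insert b B. u \<bullet> b' = \<sigma>' p \<bullet> b')" if "p \<in> D" for p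
    proof -
      obtain u where u: "u \<in> S p" "u \<bullet> b = \<tau> p" using \<tau>_att[OF \<open>p \<in> D\<close>] by blast
      have "u \<bullet> b' = \<sigma>' p \<bullet> b'" if "b' \<in> insert b B" for b'
        using that u insert.hyps insert.prems
        by (auto simp: \<sigma>'_def S_def inner_add_left inner_Basis subset_iff)
      then show ?thesis using u by (auto simp: S_def)
    qed
    ultimately show ?case by blast
  qed
  from this[of Basis] obtain \<sigma> where \<sigma>: "\<sigma> \<in> borel_measurable borel"
    "\<And>p. p \<in> D \<Longrightarrow> \<exists>u\<in>K. (p, u) \<in> R \<and> (\<forall>b\<in>Basis. u \<bullet> b = \<sigma> p \<bullet> b)" by auto
  have "\<sigma> p \<in> K \<and> (p, \<sigma> p) \<in> R" if "p \<in> D" for p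
    using \<sigma>(2)[OF that] by (metis euclidean_eqI)
  then show ?thesis using \<sigma>(1) by (intro bexI[of _ \<sigma>]) (auto simp: D_def)
qed

section \<open>Growth estimates and existence for differential equations\<close>

lemma abs_continuous_on_subinterval:
  assumes "abs_continuous_on a b f" "a \<le> s" "t \<le> b"
  shows "abs_continuous_on s t f"
proof -
  have "{s..t} \<subseteq> {a..b}" using assms by auto
  then show ?thesis
    using assms(1) unfolding abs_continuous_on_def by (meson order_trans)
qed

lemma has_integral_norm_bound_negligible:
  fixes g :: "real \<Rightarrow> 'a::euclidean_space"
  assumes int: "(g has_integral I) {s..t}" and h: "h integrable_on {s..t}" and N: "negligible N"
    and le: "\<And>r. r \<in> {s..t} - N \<Longrightarrow> norm (g r) \<le> h r"
  shows "norm I \<le> integral {s..t} h"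
proof -
  define g' where "g' r = (if r \<in> N then 0 else g r)" for r
  define h' where "h' r = (if r \<in> N then 0 else h r)" for r
  have g': "(g' has_integral I) {s..t}"
    by (rule has_integral_spike[OF N _ int]) (simp add: g'_def)
  have h': "(h' has_integral integral {s..t} h) {s..t}"
    by (rule has_integral_spike[OF N _ integrable_integral[OF h]]) (simp add: h'_def)
  have "norm (integral {s..t} g') \<le> integral {s..t} h'"
    using g' h' le by (intro integral_norm_bound_integral) (auto simp: g'_def h'_def has_integral_iff)
  then show ?thesis using g' h' by (simp add: has_integral_iff)
qed

lemma lipschitz_on_of_bounded_derivative_integral:
  fixes z :: "real \<Rightarrow> 'a::euclidean_space"
  assumes int: "\<And>s t. a \<le> s \<Longrightarrow> s \<le> t \<Longrightarrow> t \<le> b \<Longrightarrow> (g has_integral z t - z s) {s..t}"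
    and N: "negligible N" and M: "0 \<le> M" and le: "\<And>r. r \<in> {a..b} - N \<Longrightarrow> norm (g r) \<le> M"
  shows "M-lipschitz_on {a..b} z"
proof (rule lipschitz_onI[OF _ M])
  have main: "norm (z t - z s) \<le> M * (t - s)" if "a \<le> s" "s \<le> t" "t \<le> b" for s t
  proof -
    have "norm (z t - z s) \<le> integral {s..t} (\<lambda>_. M)"
      using that by (intro has_integral_norm_bound_negligible[OF int _ N] le) auto
    then show ?thesis using that by (simp add: mult.commute)
  qed
  fix s t assume "s \<in> {a..b}" "t \<in> {a..b}"
  then show "dist (z s) (z t) \<le> M * dist s t"
    using main[of s t] main[of t s]
    by (cases "s \<le> t") (auto simp: dist_norm norm_minus_commute abs_minus_commute)
qed

text \<open>
  A form of Gronwall's inequality, obtained from the maximum of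
  \<open>exp(-2Ct) (1 + |x(t)|)\<close>: with this weight the integral term accounts for at most half of the maximum.
\<close>

lemma linear_growth_bound:
  fixes x :: "real \<Rightarrow> 'a::euclidean_space"
  assumes C: "C > 0" and cont: "continuous_on {0..T} x" and N: "negligible N"
    and int: "\<And>t. t \<in> {0..T} \<Longrightarrow> (g has_integral x t - x 0) {0..t}"
    and growth: "\<And>t. t \<in> {0..T} - N \<Longrightarrow> norm (g t) \<le> C * (1 + norm (x t))"
    and t: "t \<in> {0..T}"
  shows "1 + norm (x t) \<le> 2 * (1 + norm (x 0)) * exp (2 * C * T)"
proof -
  define w where "w s = exp (- (2 * C * s)) * (1 + norm (x s))" for s
  have "continuous_on {0..T} w"
    unfolding w_def by (intro continuous_intros cont)
  moreover have "{0..T} \<noteq> {}" using t by auto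
  ultimately obtain r where r: "r \<in> {0..T}" "\<And>s. s \<in> {0..T} \<Longrightarrow> w s \<le> w r"
    using continuous_attains_sup[of "{0..T}" w] by auto
  have ws: "1 + norm (x s) = w s * exp (2 * C * s)" for s
    by (simp add: w_def exp_minus field_simps)
  have wpos: "w r > 0" by (simp add: w_def add_pos_nonneg)
  have bound: "1 + norm (x s) \<le> w r * exp (2 * C * s)" if "s \<in> {0..T}" for s
    unfolding ws[of s] using r(2)[OF that] by (intro mult_right_mono) auto
  have der: "((\<lambda>s. w r / 2 * exp (2 * C * s)) has_vector_derivative C * (w r * exp (2 * C * s))) (at s within {0..r})" for s
    by (auto intro!: derivative_eq_intros simp: has_real_derivative_iff_has_vector_derivative[symmetric])
  have h: "((\<lambda>s. C * (w r * exp (2 * C * s))) has_integral w r / 2 * exp (2 * C * r) - w r / 2 * exp (2 * C * 0)) {0..r}"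
    using r(1) by (intro fundamental_theorem_of_calculus der) auto
  have "norm (x r - x 0) \<le> integral {0..r} (\<lambda>s. C * (w r * exp (2 * C * s)))"
  proof (rule has_integral_norm_bound_negligible[OF int[OF r(1)] _ N])
    show "(\<lambda>s. C * (w r * exp (2 * C * s))) integrable_on {0..r}" using h by blast
    fix s assume s: "s \<in> {0..r} - N"
    then have "norm (g s) \<le> C * (1 + norm (x s))" using r(1) by (intro growth) auto
    also have "\<dots> \<le> C * (w r * exp (2 * C * s))"
      using C s r(1) by (intro mult_left_mono bound) auto
    finally show "norm (g s) \<le> C * (w r * exp (2 * C * s))" .
  qed
  also have "\<dots> \<le> w r / 2 * exp (2 * C * r)"
    unfolding integral_unique[OF h] using wpos by simp
  finally have "norm (x r) \<le> norm (x 0) + w r / 2 * exp (2 * C * r)"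
    using norm_triangle_sub[of "x r" "x 0"] by linarith
  then have "w r / 2 * exp (2 * C * r) \<le> 1 + norm (x 0)" using ws[of r] by simp
  moreover have "w r / 2 * 1 \<le> w r / 2 * exp (2 * C * r)"
    using wpos C r(1) by (intro mult_left_mono) auto
  ultimately have "w r \<le> 2 * (1 + norm (x 0))" by simp
  then have "w r * exp (2 * C * t) \<le> 2 * (1 + norm (x 0)) * exp (2 * C * T)"
    using t C wpos by (intro mult_mono) auto
  then show ?thesis using bound[OF t] by simp
qed

text \<open>
  Picard's theorem on the whole interval. Substituting \<open>x(t) = exp(2L't) y(t)\<close> with \<open>L' = L + 1\<close> makes
  the integral operator a contraction with constant \<open>1/2\<close> in the supremum norm, however
  long the interval is.
\<close>

lemma lipschitz_ode_solution_exists: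
  fixes f :: "'a::euclidean_space \<Rightarrow> 'a"
  assumes lip: "L-lipschitz_on UNIV f" and T: "0 \<le> T"
  shows "\<exists>x. x 0 = x0 \<and> (\<forall>t\<in>{0..T}. (x has_vector_derivative f (x t)) (at t within {0..T}))"
proof -
  define L' where "L' = L + 1"
  have L': "L' > 0" using lipschitz_on_nonneg[OF lip] by (simp add: L'_def)
  have lip': "norm (f a - f b) \<le> L' * norm (a - b)" for a b
  proof -
    have "norm (f a - f b) \<le> L * norm (a - b)" using lip by (auto simp: lipschitz_on_def dist_norm)
    also have "\<dots> \<le> L' * norm (a - b)" by (intro mult_right_mono) (auto simp: L'_def)
    finally show ?thesis .
  qed
  have fcont: "continuous_on A f" for A
    using lipschitz_on_continuous_on[OF lip] continuous_on_subset by blast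
  \<comment> \<open>The space of bounded continuous functions lives on the whole line; clamping the argument extends the
    operator to it.\<close>
  define cl where "cl t = max 0 (min T t)" for t
  have cl: "cl t \<in> {0..T}" "t \<in> {0..T} \<Longrightarrow> cl t = t" for t using T by (auto simp: cl_def)
  have clc: "continuous_on UNIV cl" unfolding cl_def[abs_def] by (intro continuous_intros)
  define F where "F y s = f (exp (2 * L' * s) *\<^sub>R apply_bcontfun y s)" for y :: "real \<Rightarrow>\<^sub>C 'a" and s
  have Fcont: "continuous_on A (F y)" for y A
    unfolding F_def[abs_def]
    by (intro continuous_on_compose2[OF fcont[of UNIV]] continuous_intros continuous_on_subset[OF continuous_on_apply_bcontfun]) auto
  have Fint: "F y integrable_on {a..b}" for y a b
    by (intro integrable_continuous_real Fcont)
  define J where "J y t = exp (- (2 * L' * t)) *\<^sub>R (x0 + integral {0..t} (F y))" for y t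
  have Jcont: "continuous_on {0..T} (J y)" for y
    unfolding J_def[abs_def] by (intro continuous_intros indefinite_integral_continuous_1 Fint)
  have J_bc: "(\<lambda>t. J y (cl t)) \<in> bcontfun" for y
  proof -
    have "continuous_on UNIV (\<lambda>t. J y (cl t))"
      by (rule continuous_on_compose2[OF Jcont clc]) (use cl in auto)
    moreover have "bounded (J y ` {0..T})"
      by (intro compact_imp_bounded compact_continuous_image Jcont) auto
    then have "bounded (range (\<lambda>t. J y (cl t)))"
      by (rule bounded_subset) (use cl in auto)
    ultimately show ?thesis by (simp add: bcontfun_def)
  qed
  define \<Phi> where "\<Phi> y = Bcontfun (\<lambda>t. J y (cl t))" for y
  have \<Phi>: "apply_bcontfun (\<Phi> y) t = J y (cl t)" for y t
    by (simp add: \<Phi>_def Bcontfun_inverse[OF J_bc])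
  have contr: "dist (\<Phi> y) (\<Phi> v) \<le> 1/2 * dist y v" for y v
  proof (rule dist_bound)
    fix t
    define s where "s = cl t"
    have s: "0 \<le> s" using cl(1)[of t] by (simp add: s_def)
    define d where "d = dist y v"
    have d: "0 \<le> d" by (simp add: d_def)
    have der: "((\<lambda>r. d / 2 * exp (2 * L' * r)) has_vector_derivative L' * (exp (2 * L' * r) * d)) (at r within {0..s})" for r
      by (auto intro!: derivative_eq_intros simp: has_real_derivative_iff_has_vector_derivative[symmetric])
    have h: "((\<lambda>r. L' * (exp (2 * L' * r) * d)) has_integral d / 2 * exp (2 * L' * s) - d / 2 * exp (2 * L' * 0)) {0..s}"
      using s by (intro fundamental_theorem_of_calculus der) auto
    have "norm (integral {0..s} (\<lambda>r. F y r - F v r)) \<le> integral {0..s} (\<lambda>r. L' * (exp (2 * L' * r) * d))"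
    proof (rule integral_norm_bound_integral)
      show "(\<lambda>r. F y r - F v r) integrable_on {0..s}" by (intro integrable_diff Fint)
      show "(\<lambda>r. L' * (exp (2 * L' * r) * d)) integrable_on {0..s}" using h by blast
      fix r
      have "norm (F y r - F v r) \<le> L' * norm (exp (2 * L' * r) *\<^sub>R y r - exp (2 * L' * r) *\<^sub>R v r)"
        unfolding F_def by (rule lip')
      also have "\<dots> = L' * (exp (2 * L' * r) * dist (y r) (v r))"
        by (simp add: scaleR_diff_right[symmetric] dist_norm)
      also have "\<dots> \<le> L' * (exp (2 * L' * r) * d)"
        using L' by (intro mult_left_mono) (auto simp: d_def dist_bounded)
      finally show "norm (F y r - F v r) \<le> L' * (exp (2 * L' * r) * d)" .
    qed
    also have "\<dots> \<le> d / 2 * exp (2 * L' * s)"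
      unfolding integral_unique[OF h] using d by simp
    finally have "norm (integral {0..s} (F y) - integral {0..s} (F v)) \<le> d / 2 * exp (2 * L' * s)"
      by (simp add: integral_diff[OF Fint Fint])
    then have "exp (- (2 * L' * s)) * norm (integral {0..s} (F y) - integral {0..s} (F v)) \<le> exp (- (2 * L' * s)) * (d / 2 * exp (2 * L' * s))"
      by (intro mult_left_mono) auto
    also have "\<dots> = d / 2" by (simp add: exp_minus field_simps)
    finally show "dist (\<Phi> y t) (\<Phi> v t) \<le> 1/2 * dist y v"
      by (simp add: \<Phi> J_def s_def[symmetric] d_def dist_norm scaleR_diff_right[symmetric])
  qed
  have "\<exists>!y. \<Phi> y = y"
    by (rule banach_fix_type[where c="1/2"]) (use contr in auto)
  then obtain y where y: "\<Phi> y = y" by blast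
  define x where "x t = exp (2 * L' * t) *\<^sub>R apply_bcontfun y t" for t
  have xF: "f (x s) = F y s" for s by (simp add: x_def F_def)
  have x_eq: "x t = x0 + integral {0..t} (F y)" if "t \<in> {0..T}" for t
  proof -
    have "apply_bcontfun y t = J y t" using \<Phi>[of y t] y cl(2)[OF that] by simp
    then show ?thesis by (simp add: x_def J_def exp_minus)
  qed
  have "(x has_vector_derivative f (x t)) (at t within {0..T})" if t: "t \<in> {0..T}" for t
  proof -
    have "((\<lambda>t. x0 + integral {0..t} (F y)) has_vector_derivative 0 + F y t) (at t within {0..T})"
      by (intro has_vector_derivative_add has_vector_derivative_const integral_has_vector_derivative Fcont t)
    then show ?thesis
      unfolding xF by (intro has_vector_derivative_transform[OF t x_eq]) auto
  qed
  moreover have "x 0 = x0" using x_eq[of 0] T by simp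
  ultimately show ?thesis by blast
qed

section \<open>Velocities of uniform limits of trajectories\<close>

lemma AE_lebesgue_on_iff_negligible:
  assumes "S \<in> sets lebesgue"
  shows "(AE t in lebesgue_on S. P t) \<longleftrightarrow> (\<exists>N. negligible N \<and> (\<forall>t\<in>S - N. P t))"
proof -
  have "(AE t in lebesgue_on S. P t) \<longleftrightarrow> (AE t in lebesgue. t \<in> S \<longrightarrow> P t)"
    using assms by (simp add: AE_restrict_space_iff)
  also have "\<dots> \<longleftrightarrow> (\<exists>N. negligible N \<and> (\<forall>t\<in>S - N. P t))"
    by (simp add: eventually_ae_filter negligible_iff_null_sets Bex_def subset_iff) blast
  finally show ?thesis .
qed

lemma integrable_bounded_lebesgue_on:
  fixes f :: "real \<Rightarrow> 'a::euclidean_space"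
  assumes S: "S \<in> lmeasurable" and f: "f \<in> borel_measurable (lebesgue_on S)"
    and N: "negligible N" and le: "\<And>t. t \<in> S - N \<Longrightarrow> norm (f t) \<le> B"
  shows "integrable (lebesgue_on S) f"
proof -
  interpret finite_measure "lebesgue_on S" using finite_measure_lebesgue_on[OF S] .
  have "AE t in lebesgue_on S. norm (f t) \<le> B"
    using S N le by (subst AE_lebesgue_on_iff_negligible) auto
  then show ?thesis by (rule integrable_const_bound[OF _ f])
qed

lemma compact_continuous_uniform_bound:
  fixes f :: "'i::finite \<Rightarrow> 'a::topological_space \<Rightarrow> 'b::real_normed_vector"
  assumes K: "compact K" and f: "\<And>i. continuous_on K (f i)"
  shows "\<exists>B\<ge>0. \<forall>i. \<forall>v\<in>K. norm (f i v) \<le> B"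
proof -
  have "\<forall>i. \<exists>b. \<forall>v\<in>K. norm (f i v) \<le> b"
    using compact_imp_bounded[OF compact_continuous_image[OF f K]] by (auto simp: bounded_iff)
  then obtain b where b: "\<And>i v. v \<in> K \<Longrightarrow> norm (f i v) \<le> b i" by metis
  have "norm (f i v) \<le> (\<Sum>j\<in>UNIV. \<bar>b j\<bar>)" if "v \<in> K" for i v
  proof -
    have "norm (f i v) \<le> \<bar>b i\<bar>" using b[OF that, of i] by simp
    also have "\<dots> \<le> (\<Sum>j\<in>UNIV. \<bar>b j\<bar>)" by (rule member_le_sum) auto
    finally show ?thesis .
  qed
  then show ?thesis by (intro exI[of _ "\<Sum>j\<in>UNIV. \<bar>b j\<bar>"]) (auto intro: sum_nonneg)
qed

lemma norm_combination_le:
  fixes a :: "'s::finite \<Rightarrow> 'b::real_normed_vector"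
  assumes "\<And>i. \<bar>w i\<bar> \<le> B" "\<And>i. norm (a i) \<le> D" "0 \<le> B"
  shows "norm (\<Sum>i\<in>UNIV. w i *\<^sub>R a i) \<le> real CARD('s) * (B * D)"
proof -
  have "norm (\<Sum>i\<in>UNIV. w i *\<^sub>R a i) \<le> real (card (UNIV :: 's set)) * (B * D)"
    using assms by (intro sum_norm_bound) (auto intro!: mult_mono)
  then show ?thesis .
qed

text \<open>
  The difference quotient of \<open>z j\<close> over \<open>[t, t + h]\<close> is an average of \<open>\<Sum>i. \<phi> i (u j) A i (x j)\<close>.
  For small \<open>h\<close> and large \<open>j\<close> the factors \<open>A i (x j)\<close> are nearly the constants \<open>A i (xl t)\<close>, and what remains
  is the velocity at \<open>xl t\<close> of the average of \<open>\<phi>(u j)\<close>, a point of \<open>\<Lambda>\<close>. Hence \<open>w\<close> is a limit of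
  velocities from \<open>\<Lambda>\<close>, which form a compact set. Since all components of \<open>A\<close> are treated together,
  a single \<open>m\<close> serves the state and the cost coordinate.
\<close>

lemma velocity_of_limit_in_relaxed_velocities:
  fixes K :: "(real ^ 'n::finite) set" and \<phi> :: "'s::finite \<Rightarrow> real ^ 'n \<Rightarrow> real"
    and A :: "'s \<Rightarrow> 'a::euclidean_space \<Rightarrow> 'b::euclidean_space"
  assumes K: "compact K" and \<phi>: "\<And>i. continuous_on UNIV (\<phi> i)" and A: "\<And>i. continuous_on UNIV (A i)"
    and t: "t \<in> {0<..<T}"
    and u: "\<And>j. u j \<in> borel_measurable (lebesgue_on {0<..<T})"
    and uK: "\<And>j. AE s in lebesgue_on {0<..<T}. u j s \<in> K"
    and int: "\<And>j s r. 0 \<le> s \<Longrightarrow> s \<le> r \<Longrightarrow> r \<le> T \<Longrightarrow>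
       ((\<lambda>\<tau>. \<Sum>i\<in>UNIV. \<phi> i (u j \<tau>) *\<^sub>R A i (x j \<tau>)) has_integral z j r - z j s) {s..r}"
    and unif: "\<And>e. e > 0 \<Longrightarrow> \<exists>J. \<forall>j\<ge>J. \<forall>s\<in>{0..T}. norm (x j s - xl s) < e"
    and lim: "\<And>s. s \<in> {0..T} \<Longrightarrow> (\<lambda>j. z j s) \<longlonglongrightarrow> zl s"
    and xl: "continuous_on {0..T} xl"
    and der: "(zl has_vector_derivative w) (at t)"
  shows "\<exists>m\<in>Lambda_set K \<phi>. w = (\<Sum>i\<in>UNIV. m $ i *\<^sub>R A i (xl t))"
proof -
  have t01: "t \<in> {0..T}" using t by auto
  define V where "V m = (\<Sum>i\<in>UNIV. m $ i *\<^sub>R A i (xl t))" for m :: "real ^ 's"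
  have "compact (V ` Lambda_set K \<phi>)"
    unfolding V_def[abs_def]
    by (intro compact_continuous_image continuous_intros compact_Lambda_set K \<phi>)
  then have closed: "closed (V ` Lambda_set K \<phi>)" by (rule compact_imp_closed)
  obtain B where B: "B \<ge> 0" "\<And>i v. v \<in> K \<Longrightarrow> \<bar>\<phi> i v\<bar> \<le> B"
    using compact_continuous_uniform_bound[OF K, of \<phi>] continuous_on_subset[OF \<phi>] by auto
  have "w \<in> closure (V ` Lambda_set K \<phi>)"
    unfolding closure_approachable
  proof (intro allI impI)
    fix e :: real assume e: "e > 0"
    \<comment> \<open>The final estimate has three errors of size \<open>\<epsilon>\<close> (the derivative of the limit and the convergence at both
      endpoints) and one of size \<open>CARD('s) * B * \<epsilon>\<close> (freezing \<open>A\<close> at \<open>xl t\<close>).\<close>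
    define \<epsilon> where "\<epsilon> = e / (4 + real CARD('s) * B)"
    have \<epsilon>: "\<epsilon> > 0" "(3 + real CARD('s) * B) * \<epsilon> < e"
      using e B(1) by (auto simp: \<epsilon>_def add_pos_nonneg field_simps)
    have "\<forall>i. \<exists>\<eta>>0. \<forall>y. dist y (xl t) < \<eta> \<longrightarrow> dist (A i y) (A i (xl t)) < \<epsilon>"
      using A \<epsilon>(1) by (auto simp: continuous_on_iff)
    then obtain \<eta>' where \<eta>': "\<And>i. \<eta>' i > 0" "\<And>i y. dist y (xl t) < \<eta>' i \<Longrightarrow> dist (A i y) (A i (xl t)) < \<epsilon>"
      by metis
    define \<eta> where "\<eta> = Min (range \<eta>')"
    have \<eta>: "\<eta> > 0" using \<eta>'(1) by (simp add: \<eta>_def)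
    have \<eta>A: "norm (A i y - A i (xl t)) \<le> \<epsilon>" if "norm (y - xl t) < \<eta>" for i y
    proof -
      have "\<eta> \<le> \<eta>' i" by (simp add: \<eta>_def)
      then show ?thesis using \<eta>'(2)[of y i] that by (simp add: dist_norm)
    qed
    obtain \<delta> where \<delta>: "\<delta> > 0" "\<And>s. s \<in> {0..T} \<Longrightarrow> dist s t < \<delta> \<Longrightarrow> dist (xl s) (xl t) < \<eta> / 2"
      using xl[unfolded continuous_on_iff, rule_format, OF t01 half_gt_zero[OF \<eta>]] by blast
    obtain d where d: "d > 0" "\<And>y. norm (y - t) < d \<Longrightarrow> norm (zl y - zl t - (y - t) *\<^sub>R w) \<le> \<epsilon> * norm (y - t)"
      using der[unfolded has_vector_derivative_def has_derivative_at_alt] \<epsilon>(1) by blast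
    define l where "l = min (min \<delta> d) (T - t)"
    have l: "0 < l" "l \<le> \<delta>" "l \<le> d" "l \<le> T - t"
      using t \<delta>(1) d(1) by (auto simp: l_def)
    define h where "h = l / 2"
    have h: "h > 0" "h < \<delta>" "h < d" "t + h < T"
      using l by (auto simp: h_def)
    have th: "{t..t+h} \<subseteq> {0<..<T}" "{t..t+h} \<subseteq> {0..T}" using t h by auto
    have hdiff: "norm (zl (t + h) - zl t - h *\<^sub>R w) \<le> \<epsilon> * h"
      using d(2)[of "t + h"] h by simp
    obtain J where J: "\<And>j s. j \<ge> J \<Longrightarrow> s \<in> {0..T} \<Longrightarrow> norm (x j s - xl s) < \<eta> / 2"
      using unif[OF half_gt_zero[OF \<eta>]] by blast
    have "\<forall>\<^sub>F j in sequentially. norm (z j (t+h) - zl (t+h)) < \<epsilon> * h"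
      using lim[of "t+h"] t h \<epsilon>(1) by (simp add: tendsto_iff dist_norm)
    moreover have "\<forall>\<^sub>F j in sequentially. norm (z j t - zl t) < \<epsilon> * h"
      using lim[of t] t h \<epsilon>(1) by (simp add: tendsto_iff dist_norm)
    moreover have "\<forall>\<^sub>F j in sequentially. j \<ge> J" by (rule eventually_ge_at_top)
    ultimately have "\<forall>\<^sub>F j in sequentially. norm (z j (t+h) - zl (t+h)) < \<epsilon> * h \<and> norm (z j t - zl t) < \<epsilon> * h \<and> j \<ge> J"
      by eventually_elim simp
    then obtain j where j: "norm (z j (t+h) - zl (t+h)) < \<epsilon> * h" "norm (z j t - zl t) < \<epsilon> * h" "j \<ge> J"
      using eventually_happens' sequentially_bot by blast
    have um: "u j \<in> borel_measurable (lebesgue_on {t..t+h})"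
      by (rule measurable_restrict_mono[OF u th(1)])
    obtain N where N: "negligible N" "\<And>s. s \<in> {0<..<T} - N \<Longrightarrow> u j s \<in> K"
      using uK[of j] by (subst (asm) AE_lebesgue_on_iff_negligible) auto
    have uN: "u j s \<in> K" if "s \<in> {t..t+h} - N" for s using N(2)[of s] th(1) that by auto
    have AEK: "AE s in lebesgue_on {t..t+h}. u j s \<in> K"
      using N(1) uN by (subst AE_lebesgue_on_iff_negligible) auto
    define m where "m = (\<chi> i. (\<integral>s. \<phi> i (u j s) \<partial>lebesgue_on {t..t+h}) / h)"
    have m: "m \<in> Lambda_set K \<phi>"
      using average_in_Lambda_set[where \<phi>=\<phi>, OF K \<phi> _ um AEK] h(1) by (simp add: m_def)
    have \<phi>int: "((\<lambda>s. \<phi> i (u j s)) has_integral h * m $ i) {t..t+h}" for i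
    proof -
      have "\<phi> i \<in> borel_measurable borel" using \<phi> borel_measurable_continuous_onI by blast
      then have "(\<lambda>s. \<phi> i (u j s)) \<in> borel_measurable (lebesgue_on {t..t+h})" using um by measurable
      then have "integrable (lebesgue_on {t..t+h}) (\<lambda>s. \<phi> i (u j s))"
        using uN B(2) by (intro integrable_bounded_lebesgue_on[OF _ _ N(1), of _ _ B]) auto
      from has_integral_integral_lebesgue_on[OF this] show ?thesis
        using h(1) by (simp add: m_def)
    qed
    have "((\<lambda>s. \<Sum>i\<in>UNIV. \<phi> i (u j s) *\<^sub>R A i (xl t)) has_integral (\<Sum>i\<in>UNIV. (h * m $ i) *\<^sub>R A i (xl t))) {t..t+h}"
      by (intro has_integral_sum has_integral_scaleR_left \<phi>int) auto
    also have "(\<Sum>i\<in>UNIV. (h * m $ i) *\<^sub>R A i (xl t)) = h *\<^sub>R V m"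
      by (simp add: V_def scaleR_sum_right)
    finally have Vint: "((\<lambda>s. \<Sum>i\<in>UNIV. \<phi> i (u j s) *\<^sub>R A i (xl t)) has_integral h *\<^sub>R V m) {t..t+h}" .
    have "((\<lambda>s. (\<Sum>i\<in>UNIV. \<phi> i (u j s) *\<^sub>R A i (x j s)) - (\<Sum>i\<in>UNIV. \<phi> i (u j s) *\<^sub>R A i (xl t)))
        has_integral (z j (t+h) - z j t) - h *\<^sub>R V m) {t..t+h}"
      using t h by (intro has_integral_diff int Vint) auto
    then have "norm ((z j (t+h) - z j t) - h *\<^sub>R V m) \<le> integral {t..t+h} (\<lambda>_. real CARD('s) * (B * \<epsilon>))"
    proof (rule has_integral_norm_bound_negligible[OF _ _ N(1)])
      fix s assume s: "s \<in> {t..t+h} - N"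
      then have s': "s \<in> {0..T}" "dist s t < \<delta>" using th h by (auto simp: dist_real_def)
      have "norm (x j s - xl t) \<le> norm (x j s - xl s) + norm (xl s - xl t)"
        by (metis diff_add_cancel add_diff_eq norm_triangle_ineq)
      also have "\<dots> < \<eta> / 2 + \<eta> / 2"
        using J[OF j(3) s'(1)] \<delta>(2)[OF s'] by (simp add: dist_norm)
      finally have "norm (x j s - xl t) < \<eta>" by simp
      then have "norm (A i (x j s) - A i (xl t)) \<le> \<epsilon>" for i by (rule \<eta>A)
      then have "norm (\<Sum>i\<in>UNIV. \<phi> i (u j s) *\<^sub>R (A i (x j s) - A i (xl t))) \<le> real CARD('s) * (B * \<epsilon>)"
        using B uN[OF s] by (intro norm_combination_le) auto
      then show "norm ((\<Sum>i\<in>UNIV. \<phi> i (u j s) *\<^sub>R A i (x j s)) - (\<Sum>i\<in>UNIV. \<phi> i (u j s) *\<^sub>R A i (xl t))) \<le> real CARD('s) * (B * \<epsilon>)"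
        by (simp add: scaleR_diff_right sum_subtractf)
    qed (rule Henstock_Kurzweil_Integration.integrable_const_ivl)
    then have zV: "norm ((z j (t+h) - z j t) - h *\<^sub>R V m) \<le> real CARD('s) * B * \<epsilon> * h"
      using h(1) by (simp add: mult_ac)
    have "h *\<^sub>R (V m - w) = (zl (t+h) - zl t - h *\<^sub>R w) - ((z j (t+h) - z j t) - h *\<^sub>R V m)
         + (z j (t+h) - zl (t+h)) - (z j t - zl t)"
      by (simp add: algebra_simps)
    also have "norm \<dots> \<le> norm (zl (t+h) - zl t - h *\<^sub>R w) + norm ((z j (t+h) - z j t) - h *\<^sub>R V m)
         + norm (z j (t+h) - zl (t+h)) + norm (z j t - zl t)"
      by (meson add_mono norm_triangle_ineq norm_triangle_ineq4 norm_triangle_le norm_triangle_le_diff order_refl)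
    also have "\<dots> \<le> \<epsilon> * h + real CARD('s) * B * \<epsilon> * h + \<epsilon> * h + \<epsilon> * h"
      using hdiff zV j by linarith
    also have "\<dots> = h * ((3 + real CARD('s) * B) * \<epsilon>)" by (simp add: algebra_simps)
    finally have "h * norm (V m - w) \<le> h * ((3 + real CARD('s) * B) * \<epsilon>)" using h(1) by simp
    then have "norm (V m - w) \<le> (3 + real CARD('s) * B) * \<epsilon>" using h(1) by simp
    then have "dist (V m) w < e" using \<epsilon>(2) by (simp add: dist_norm)
    then show "\<exists>y\<in>V ` Lambda_set K \<phi>. dist y w < e" using m by blast
  qed
  then have "w \<in> V ` Lambda_set K \<phi>" using closed by simp
  then show ?thesis by (auto simp: V_def)
qed

text \<open>
  This is the only place where the hypothesis on minimizers is used: \<open>m\<close> competes in the minimum with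
  \<open>\<xi> = Q(x) m\<close>, which is attained by compactness of \<open>\<Lambda>\<close>.
\<close>

lemma control_realizing_relaxed_velocity:
  fixes K :: "(real ^ 'n::finite) set" and \<phi> :: "'s::finite \<Rightarrow> real ^ 'n \<Rightarrow> real"
    and c :: "'s \<Rightarrow> real ^ 'N::finite \<Rightarrow> real" and Q :: "'s \<Rightarrow> real ^ 'N \<Rightarrow> real ^ 'N"
  assumes K: "compact K" and \<phi>: "\<And>i. continuous_on UNIV (\<phi> i)"
    and min_in_L: "\<And>\<xi> m. \<xi> \<in> (\<lambda>m. Q_matrix Q x *v m) ` Lambda_set K \<phi> \<Longrightarrow>
           is_arg_min (\<lambda>m. vec_of c x \<bullet> m) (\<lambda>m. m \<in> Lambda_set K \<phi> \<and> \<xi> = Q_matrix Q x *v m) m \<Longrightarrow>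
           m \<in> L_set K \<phi>"
    and m: "m \<in> Lambda_set K \<phi>"
  shows "\<exists>v\<in>K. (\<Sum>i\<in>UNIV. \<phi> i v *\<^sub>R Q i x) = (\<Sum>i\<in>UNIV. m $ i *\<^sub>R Q i x) \<and>
      (\<Sum>i\<in>UNIV. c i x * \<phi> i v) \<le> (\<Sum>i\<in>UNIV. c i x * m $ i)"
proof -
  have Qv: "Q_matrix Q x *v p = (\<Sum>i\<in>UNIV. p $ i *\<^sub>R Q i x)" for p
    by (simp add: vec_eq_iff matrix_vector_mult_def Q_matrix_def sum_component mult.commute)
  have cv: "vec_of c x \<bullet> p = (\<Sum>i\<in>UNIV. c i x * p $ i)" for p
    by (simp add: inner_vec_def vec_of_def)
  define S where "S = Lambda_set K \<phi> \<inter> {p. (\<Sum>i\<in>UNIV. p $ i *\<^sub>R Q i x) = (\<Sum>i\<in>UNIV. m $ i *\<^sub>R Q i x)}"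
  have "compact S"
    unfolding S_def
    by (intro compact_Int_closed compact_Lambda_set K \<phi> closed_Collect_eq continuous_intros)
  moreover have "S \<noteq> {}" using m by (auto simp: S_def)
  moreover have "continuous_on S (\<lambda>q. vec_of c x \<bullet> q)" by (intro continuous_intros)
  ultimately obtain p where p: "p \<in> S" "\<And>q. q \<in> S \<Longrightarrow> vec_of c x \<bullet> p \<le> vec_of c x \<bullet> q"
    using continuous_attains_inf[of S "\<lambda>q. vec_of c x \<bullet> q"] by blast
  have "is_arg_min (\<lambda>m. vec_of c x \<bullet> m) (\<lambda>q. q \<in> Lambda_set K \<phi> \<and> Q_matrix Q x *v m = Q_matrix Q x *v q) p"
    using p by (auto simp: is_arg_min_def Qv S_def not_less)
  then have "p \<in> L_set K \<phi>" using m by (intro min_in_L) auto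
  then obtain v where v: "v \<in> K" "p = vec_of \<phi> v" by (auto simp: L_set_def)
  then have pv: "p $ i = \<phi> i v" for i by (simp add: vec_of_def)
  have "(\<Sum>i\<in>UNIV. c i x * \<phi> i v) \<le> (\<Sum>i\<in>UNIV. c i x * m $ i)"
    using p(2)[of m] m by (simp add: cv S_def pv)
  moreover have "(\<Sum>i\<in>UNIV. \<phi> i v *\<^sub>R Q i x) = (\<Sum>i\<in>UNIV. m $ i *\<^sub>R Q i x)"
    using p(1) by (simp add: S_def pv)
  ultimately show ?thesis using v(1) by blast
qed

section \<open>Admissible pairs and their running cost\<close>

lemma C1_function_imp_continuous_on:
  assumes "C1_function f"
  shows "continuous_on UNIV f"
  using assms unfolding C1_function_def
  by (meson continuous_at_imp_continuous_on has_derivative_continuous)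

lemma admissible_imp_negligible:
  assumes "admissible T K x0 \<phi> Q x u"
  obtains N where "negligible N" "\<And>t. t \<in> {0<..<T} - N \<Longrightarrow> u t \<in> K"
    "\<And>t. t \<in> {0<..<T} - N \<Longrightarrow> (x has_vector_derivative (\<Sum>i\<in>UNIV. \<phi> i (u t) *\<^sub>R Q i (x t))) (at t)"
proof -
  have "AE t in lebesgue_on {0<..<T}. u t \<in> K \<and> (x has_vector_derivative (\<Sum>i\<in>UNIV. \<phi> i (u t) *\<^sub>R Q i (x t))) (at t)"
    using assms by (simp add: admissible_def)
  then show ?thesis using that by (subst (asm) AE_lebesgue_on_iff_negligible) auto
qed

lemma admissible_has_integral:
  assumes adm: "admissible T K x0 \<phi> Q x u" and st: "0 \<le> s" "s \<le> t" "t \<le> T"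
  shows "((\<lambda>\<tau>. \<Sum>i\<in>UNIV. \<phi> i (u \<tau>) *\<^sub>R Q i (x \<tau>)) has_integral x t - x s) {s..t}"
proof -
  obtain N where N: "negligible N"
    "\<And>t. t \<in> {0<..<T} - N \<Longrightarrow> (x has_vector_derivative (\<Sum>i\<in>UNIV. \<phi> i (u t) *\<^sub>R Q i (x t))) (at t)"
    using admissible_imp_negligible[OF adm] by metis
  have "abs_continuous_on 0 T x" using adm by (simp add: admissible_def)
  then have "abs_continuous_on s t x" by (rule abs_continuous_on_subinterval[OF _ st(1,3)])
  then show ?thesis
    using st by (intro abs_continuous_on_has_integral_derivative[OF st(2) _ N(1)] N(2)) auto
qed

text \<open>
  The bound is uniform over all controls because \<open>\<phi>\<close> is bounded on \<open>K\<close> and Lipschitz fields grow at most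
  linearly.
\<close>

lemma admissible_states_bounded:
  fixes K :: "(real ^ 'n::finite) set" and \<phi> :: "'s::finite \<Rightarrow> real ^ 'n \<Rightarrow> real"
    and Q :: "'s \<Rightarrow> real ^ 'N::finite \<Rightarrow> real ^ 'N"
  assumes K: "compact K" and \<phi>: "\<And>i. continuous_on UNIV (\<phi> i)"
    and Q: "\<And>i. \<exists>C. C-lipschitz_on UNIV (Q i)"
  shows "\<exists>R. \<forall>x u. admissible T K x0 \<phi> Q x u \<longrightarrow> (\<forall>t\<in>{0..T}. norm (x t) \<le> R)"
proof -
  obtain B where B: "B \<ge> 0" "\<And>i v. v \<in> K \<Longrightarrow> \<bar>\<phi> i v\<bar> \<le> B"
    using compact_continuous_uniform_bound[OF K, of \<phi>] continuous_on_subset[OF \<phi>] by auto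
  obtain l where l: "\<And>i. (l i)-lipschitz_on UNIV (Q i)" using Q by metis
  define D where "D = (\<Sum>i\<in>UNIV. norm (Q i 0) + l i)"
  have lpos: "0 \<le> l i" for i using lipschitz_on_nonneg[OF l] .
  have D: "norm (Q i y) \<le> D * (1 + norm y)" for i y
  proof -
    have "dist (Q i y) (Q i 0) \<le> l i * dist y 0" by (rule lipschitz_onD[OF l UNIV_I UNIV_I])
    then have "norm (Q i y) \<le> norm (Q i 0) + l i * norm y"
      using norm_triangle_sub[of "Q i y" "Q i 0"] by (simp add: dist_norm)
    also have "\<dots> \<le> (norm (Q i 0) + l i) * (1 + norm y)"
      using lpos[of i] by (simp add: algebra_simps)
    also have "\<dots> \<le> D * (1 + norm y)"
      unfolding D_def using lpos by (intro mult_right_mono member_le_sum) auto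
    finally show ?thesis .
  qed
  define C where "C = real CARD('s) * (B * D) + 1"
  have "0 \<le> D" unfolding D_def using lpos by (intro sum_nonneg) auto
  then have C: "C > 0" using B(1) by (auto simp: C_def intro: add_nonneg_pos)
  have "norm (x t) \<le> 2 * (1 + norm x0) * exp (2 * C * T)"
    if adm: "admissible T K x0 \<phi> Q x u" and t: "t \<in> {0..T}" for x u t
  proof -
    obtain N where N: "negligible N" "\<And>t. t \<in> {0<..<T} - N \<Longrightarrow> u t \<in> K"
      using admissible_imp_negligible[OF adm] by metis
    have x0: "x 0 = x0" using adm by (simp add: admissible_def)
    have "1 + norm (x t) \<le> 2 * (1 + norm (x 0)) * exp (2 * C * T)"
    proof (rule linear_growth_bound[OF C _ _ _ _ t])
      show "continuous_on {0..T} x"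
        using adm by (auto simp: admissible_def intro: abs_continuous_on_imp_continuous_on)
      show "negligible (N \<union> {0, T})" using N(1) by (simp add: negligible_Un negligible_insert)
      show "((\<lambda>\<tau>. \<Sum>i\<in>UNIV. \<phi> i (u \<tau>) *\<^sub>R Q i (x \<tau>)) has_integral x t - x 0) {0..t}" if "t \<in> {0..T}" for t
        using that by (intro admissible_has_integral[OF adm]) auto
      fix \<tau> assume "\<tau> \<in> {0..T} - (N \<union> {0, T})"
      then have "u \<tau> \<in> K" by (intro N(2)) auto
      then have "norm (\<Sum>i\<in>UNIV. \<phi> i (u \<tau>) *\<^sub>R Q i (x \<tau>)) \<le> real CARD('s) * (B * (D * (1 + norm (x \<tau>))))"
        using B D by (intro norm_combination_le) auto
      also have "\<dots> \<le> C * (1 + norm (x \<tau>))"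
        by (simp add: C_def algebra_simps)
      finally show "norm (\<Sum>i\<in>UNIV. \<phi> i (u \<tau>) *\<^sub>R Q i (x \<tau>)) \<le> C * (1 + norm (x \<tau>))" .
    qed
    then show ?thesis by (simp add: x0)
  qed
  then show ?thesis by blast
qed

text \<open>
  A constant control leads to an autonomous equation with Lipschitz right-hand side. Without such a pair the
  minimization would range over the empty set.
\<close>

lemma admissible_pair_exists:
  fixes K :: "(real ^ 'n::finite) set" and \<phi> :: "'s::finite \<Rightarrow> real ^ 'n \<Rightarrow> real"
    and Q :: "'s \<Rightarrow> real ^ 'N::finite \<Rightarrow> real ^ 'N"
  assumes T: "0 < T" and K: "K \<noteq> {}"
    and Q: "\<And>i. \<exists>C. C-lipschitz_on UNIV (Q i)"
  shows "\<exists>x u. admissible T K x0 \<phi> Q x u"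
proof -
  obtain v where v: "v \<in> K" using K by blast
  obtain l where l: "\<And>i. (l i)-lipschitz_on UNIV (Q i)" using Q by metis
  define f where "f y = (\<Sum>i\<in>UNIV. \<phi> i v *\<^sub>R Q i y)" for y
  have f: "(\<Sum>i\<in>UNIV. \<bar>\<phi> i v\<bar> * l i)-lipschitz_on UNIV f"
  proof (rule lipschitz_onI)
    fix y y'
    have "dist (f y) (f y') = norm (\<Sum>i\<in>UNIV. \<phi> i v *\<^sub>R (Q i y - Q i y'))"
      by (simp add: f_def dist_norm scaleR_diff_right sum_subtractf)
    also have "\<dots> \<le> (\<Sum>i\<in>UNIV. \<bar>\<phi> i v\<bar> * l i * dist y y')"
    proof (rule sum_norm_le)
      fix i
      have "norm (Q i y - Q i y') \<le> l i * dist y y'" using l[of i] by (auto simp: lipschitz_on_def dist_norm)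
      then show "norm (\<phi> i v *\<^sub>R (Q i y - Q i y')) \<le> \<bar>\<phi> i v\<bar> * l i * dist y y'"
        by (simp add: mult.assoc mult_left_mono)
    qed
    finally show "dist (f y) (f y') \<le> (\<Sum>i\<in>UNIV. \<bar>\<phi> i v\<bar> * l i) * dist y y'"
      by (simp add: sum_distrib_right)
  qed (auto intro!: sum_nonneg mult_nonneg_nonneg lipschitz_on_nonneg[OF l])
  obtain x where x: "x 0 = x0" "\<And>t. t \<in> {0..T} \<Longrightarrow> (x has_vector_derivative f (x t)) (at t within {0..T})"
    using lipschitz_ode_solution_exists[OF f, of T x0] T by auto
  have xc: "continuous_on {0..T} x"
    using x(2) by (meson continuous_on_eq_continuous_within has_vector_derivative_continuous)
  have fc: "continuous_on UNIV f" using f lipschitz_on_continuous_on by blast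
  have "compact ((\<lambda>t. f (x t)) ` {0..T})"
    by (intro compact_continuous_image continuous_on_compose2[OF fc xc]) auto
  from compact_imp_bounded[OF this] obtain M where "\<forall>y\<in>(\<lambda>t. f (x t)) ` {0..T}. norm y \<le> M"
    unfolding bounded_iff by blast
  then have M: "norm (f (x t)) \<le> M" if "t \<in> {0..T}" for t using that by blast
  have "0 \<le> norm (f (x 0))" by simp
  also have "\<dots> \<le> M" using T by (intro M) auto
  finally have "M \<ge> 0" .
  have "M-lipschitz_on {0..T} x"
  proof (rule lipschitz_on_of_bounded_derivative_integral[OF _ negligible_empty \<open>M \<ge> 0\<close>])
    fix s t assume "0 \<le> s" "s \<le> t" "t \<le> T"
    then show "((\<lambda>t. f (x t)) has_integral x t - x s) {s..t}"
      by (intro fundamental_theorem_of_calculus has_vector_derivative_within_subset[OF x(2)]) auto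
  qed (use M in auto)
  then have "abs_continuous_on 0 T x" by (rule lipschitz_imp_abs_continuous_on)
  moreover have "(x has_vector_derivative (\<Sum>i\<in>UNIV. \<phi> i v *\<^sub>R Q i (x t))) (at t)" if "t \<in> {0<..<T}" for t
    using x(2)[of t] that at_within_interior[of t "{0..T}"] by (simp add: f_def)
  then have "AE t in lebesgue_on {0<..<T}. (x has_vector_derivative (\<Sum>i\<in>UNIV. \<phi> i v *\<^sub>R Q i (x t))) (at t)"
    by (auto intro!: AE_I2 simp: space_restrict_space)
  ultimately have "admissible T K x0 \<phi> Q x (\<lambda>_. v)"
    using v x(1) by (auto simp: admissible_def L_infinity_def)
  then show ?thesis by blast
qed

text \<open>
  Adjoining the running cost as a last coordinate turns the cost into an endpoint value and lets state and
  cost be treated by the same integral equation.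
\<close>

lemma extended_state_exists:
  fixes K :: "(real ^ 'n::finite) set" and \<phi> :: "'s::finite \<Rightarrow> real ^ 'n \<Rightarrow> real"
    and Q :: "'s \<Rightarrow> real ^ 'N::finite \<Rightarrow> real ^ 'N"
  assumes T: "0 < T" and K: "compact K" and \<phi>: "\<And>i. continuous_on UNIV (\<phi> i)"
    and c: "\<And>i. continuous_on UNIV (c i)" and Q: "\<And>i. continuous_on UNIV (Q i)"
    and adm: "admissible T K x0 \<phi> Q x u"
  shows "\<exists>z. z 0 = (x0, 0) \<and> snd (z T) = cost T c \<phi> x u \<and> (\<forall>t\<in>{0..T}. fst (z t) = x t) \<and>
     (\<forall>s t. 0 \<le> s \<longrightarrow> s \<le> t \<longrightarrow> t \<le> T \<longrightarrow>
        ((\<lambda>\<tau>. \<Sum>i\<in>UNIV. \<phi> i (u \<tau>) *\<^sub>R (Q i (x \<tau>), c i (x \<tau>))) has_integral z t - z s) {s..t})"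
proof -
  define E where "E \<tau> = (\<Sum>i\<in>UNIV. \<phi> i (u \<tau>) *\<^sub>R (Q i (x \<tau>), c i (x \<tau>)))" for \<tau>
  have u: "u \<in> borel_measurable (lebesgue_on {0<..<T})" and xc: "continuous_on {0..T} x" and x0: "x 0 = x0"
    using adm by (auto simp: admissible_def L_infinity_def intro: abs_continuous_on_imp_continuous_on)
  obtain N where N: "negligible N" "\<And>t. t \<in> {0<..<T} - N \<Longrightarrow> u t \<in> K"
    using admissible_imp_negligible[OF adm] by metis
  have A: "continuous_on S (\<lambda>y. (Q i y, c i y))" for i S
    by (intro continuous_on_Pair continuous_on_subset[OF Q] continuous_on_subset[OF c]) auto
  have Em: "E \<in> borel_measurable (lebesgue_on {0<..<T})"
    unfolding E_def[abs_def]
  proof (intro borel_measurable_sum borel_measurable_scaleR)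
    fix i
    have "\<phi> i \<in> borel_measurable borel" using \<phi> borel_measurable_continuous_onI by blast
    then show "(\<lambda>\<tau>. \<phi> i (u \<tau>)) \<in> borel_measurable (lebesgue_on {0<..<T})" using u by measurable
    show "(\<lambda>\<tau>. (Q i (x \<tau>), c i (x \<tau>))) \<in> borel_measurable (lebesgue_on {0<..<T})"
      by (intro continuous_imp_measurable_on_sets_lebesgue continuous_on_compose2[OF A[of UNIV]] continuous_on_subset[OF xc]) auto
  qed
  obtain B where B: "B \<ge> 0" "\<And>i v. v \<in> K \<Longrightarrow> \<bar>\<phi> i v\<bar> \<le> B"
    using compact_continuous_uniform_bound[OF K, of \<phi>] continuous_on_subset[OF \<phi>] by auto
  have "\<exists>D\<ge>0. \<forall>i. \<forall>\<tau>\<in>{0..T}. norm (Q i (x \<tau>), c i (x \<tau>)) \<le> D"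
    by (intro compact_continuous_uniform_bound continuous_on_compose2[OF A[of UNIV] xc]) auto
  then obtain D where D: "\<And>i \<tau>. \<tau> \<in> {0..T} \<Longrightarrow> norm (Q i (x \<tau>), c i (x \<tau>)) \<le> D"
    by blast
  have Eint: "integrable (lebesgue_on {0<..<T}) E"
  proof (rule integrable_bounded_lebesgue_on[OF _ Em N(1)])
    fix \<tau> assume "\<tau> \<in> {0<..<T} - N"
    then show "norm (E \<tau>) \<le> real CARD('s) * (B * D)"
      unfolding E_def using B D N(2) by (intro norm_combination_le) auto
  qed simp
  have Eion: "E integrable_on {0..T}"
    using integrable_on_lebesgue_on[OF Eint] by (simp add: integrable_on_Icc_iff_Ioo)
  have Eion': "E integrable_on {s..t}" if "0 \<le> s" "t \<le> T" for s t
    by (rule integrable_on_subinterval[OF Eion]) (use that in auto)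
  have fstE: "fst (E \<tau>) = (\<Sum>i\<in>UNIV. \<phi> i (u \<tau>) *\<^sub>R Q i (x \<tau>))" for \<tau> by (simp add: E_def fst_sum)
  have sndE: "snd (E \<tau>) = (\<Sum>i\<in>UNIV. c i (x \<tau>) * \<phi> i (u \<tau>))" for \<tau> by (simp add: E_def snd_sum mult.commute)
  define z where "z t = (x0, 0) + integral {0..t} E" for t
  have "z 0 = (x0, 0)" by (simp add: z_def)
  moreover have "fst (z t) = x t" if t: "t \<in> {0..T}" for t
  proof -
    have "(fst \<circ> E has_integral fst (integral {0..t} E)) {0..t}"
      using t by (intro has_integral_linear integrable_integral Eion' bounded_linear_fst) auto
    moreover have "(fst \<circ> E has_integral x t - x 0) {0..t}"
      using admissible_has_integral[OF adm, of 0 t] t by (simp add: o_def fstE)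
    ultimately have "fst (integral {0..t} E) = x t - x 0" by (rule has_integral_unique)
    then show ?thesis by (simp add: z_def x0)
  qed
  moreover have "snd (z T) = cost T c \<phi> x u"
  proof -
    have "snd (integral {0..T} E) = integral {0..T} (snd \<circ> E)"
      by (rule integral_linear[OF Eion bounded_linear_snd, symmetric])
    also have "\<dots> = integral {0<..<T} (\<lambda>\<tau>. snd (E \<tau>))" by (simp add: integral_open_interval_real o_def)
    also have "\<dots> = (LINT \<tau>|lebesgue_on {0<..<T}. snd (E \<tau>))"
      by (rule lebesgue_integral_eq_integral[symmetric]) (use integrable_bounded_linear[OF bounded_linear_snd Eint] in auto)
    finally show ?thesis by (simp add: z_def cost_def sndE)
  qed
  moreover have "(E has_integral z t - z s) {s..t}" if "0 \<le> s" "s \<le> t" "t \<le> T" for s t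
  proof -
    have "integral {0..s} E + integral {s..t} E = integral {0..t} E"
      by (rule Henstock_Kurzweil_Integration.integral_combine) (use that in \<open>auto intro: Eion'\<close>)
    then have "z t - z s = integral {s..t} E" by (simp add: z_def algebra_simps)
    then show ?thesis using integrable_integral[OF Eion'[OF that(1,3)]] by simp
  qed
  ultimately show ?thesis unfolding E_def by blast
qed

section \<open>Existence of an optimal control\<close>

text \<open>
  The limit of the extended states of a minimizing sequence has relaxed velocities; \<open>realize\<close> turns each
  into the velocity of a control value whose cost rate is no larger, and a measurable choice of these values is
  an optimal control.
\<close>

lemma optimal_control_exists:
  fixes K :: "(real ^ 'n::finite) set" and \<phi> :: "'s::finite \<Rightarrow> real ^ 'n \<Rightarrow> real"
    and c :: "'s \<Rightarrow> real ^ 'N::finite \<Rightarrow> real" and Q :: "'s \<Rightarrow> real ^ 'N \<Rightarrow> real ^ 'N"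
  assumes T: "0 < T" and K: "compact K" "K \<noteq> {}" and \<phi>: "\<And>i. continuous_on UNIV (\<phi> i)"
    and c: "\<And>i. continuous_on UNIV (c i)" and Qlip: "\<And>i. \<exists>C. C-lipschitz_on UNIV (Q i)"
    and realize: "\<And>x m. m \<in> Lambda_set K \<phi> \<Longrightarrow>
      \<exists>v\<in>K. (\<Sum>i\<in>UNIV. \<phi> i v *\<^sub>R Q i x) = (\<Sum>i\<in>UNIV. m $ i *\<^sub>R Q i x) \<and>
        (\<Sum>i\<in>UNIV. c i x * \<phi> i v) \<le> (\<Sum>i\<in>UNIV. c i x * m $ i)"
  shows "\<exists>x u. admissible T K x0 \<phi> Q x u \<and>
     (\<forall>y v. admissible T K x0 \<phi> Q y v \<longrightarrow> cost T c \<phi> x u \<le> cost T c \<phi> y v)"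
proof -
  have Q: "continuous_on UNIV (Q i)" for i
    using Qlip lipschitz_on_continuous_on by blast
  define A where "A i y = (Q i y, c i y)" for i y
  have A: "continuous_on S (A i)" for i S
    unfolding A_def[abs_def] by (intro continuous_on_Pair continuous_on_subset[OF Q] continuous_on_subset[OF c]) auto
  define E where "E x u \<tau> = (\<Sum>i\<in>UNIV. \<phi> i (u \<tau>) *\<^sub>R A i (x \<tau>))" for x u and \<tau> :: real
  obtain R where R: "\<And>x u t. admissible T K x0 \<phi> Q x u \<Longrightarrow> t \<in> {0..T} \<Longrightarrow> norm (x t) \<le> R"
    using admissible_states_bounded[where \<phi>=\<phi> and Q=Q, OF K(1) \<phi> Qlip, of T x0] by blast
  obtain B where B: "B \<ge> 0" "\<And>i v. v \<in> K \<Longrightarrow> \<bar>\<phi> i v\<bar> \<le> B"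
    using compact_continuous_uniform_bound[OF K(1), of \<phi>] continuous_on_subset[OF \<phi>] by auto
  have "\<exists>D\<ge>0. \<forall>i. \<forall>y\<in>cball 0 R. norm (A i y) \<le> D"
    by (intro compact_continuous_uniform_bound A compact_cball)
  then obtain D where D: "D \<ge> 0" "\<And>i y. norm y \<le> R \<Longrightarrow> norm (A i y) \<le> D" by auto
  define M where "M = real CARD('s) * (B * D)"
  have M: "M \<ge> 0" using B(1) D(1) by (simp add: M_def)
  define ext where "ext x u z \<longleftrightarrow> z 0 = (x0, 0) \<and> snd (z T) = cost T c \<phi> x u \<and> (\<forall>t\<in>{0..T}. fst (z t) = x t) \<and>
     (\<forall>s t. 0 \<le> s \<longrightarrow> s \<le> t \<longrightarrow> t \<le> T \<longrightarrow> (E x u has_integral z t - z s) {s..t})" for x u z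
  have ext_ex: "\<exists>z. ext x u z" if "admissible T K x0 \<phi> Q x u" for x u
    using extended_state_exists[OF T K(1) \<phi> c Q that] unfolding ext_def E_def[abs_def] A_def .
  have ext_lip: "M-lipschitz_on {0..T} z" if adm: "admissible T K x0 \<phi> Q x u" and z: "ext x u z" for x u z
  proof -
    obtain N where N: "negligible N" "\<And>t. t \<in> {0<..<T} - N \<Longrightarrow> u t \<in> K"
      using admissible_imp_negligible[OF adm] by metis
    show ?thesis
    proof (rule lipschitz_on_of_bounded_derivative_integral[OF _ _ M])
      show "negligible (N \<union> {0, T})" using N(1) by (simp add: negligible_Un negligible_insert)
      show "(E x u has_integral z t - z s) {s..t}" if "0 \<le> s" "s \<le> t" "t \<le> T" for s t
        using z that by (simp add: ext_def)
      fix r assume "r \<in> {0..T} - (N \<union> {0, T})"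
      then show "norm (E x u r) \<le> M"
        unfolding E_def M_def using B D(2) R[OF adm] N(2) by (intro norm_combination_le) auto
    qed
  qed
  define costs where "costs = {cost T c \<phi> x u | x u. admissible T K x0 \<phi> Q x u}"
  have costs_ne: "costs \<noteq> {}" using admissible_pair_exists[where \<phi>=\<phi> and Q=Q, OF T K(2) Qlip, of x0] by (auto simp: costs_def)
  have "- (M * T) \<le> k" if k: "k \<in> costs" for k
  proof -
    obtain x u where xu: "admissible T K x0 \<phi> Q x u" "k = cost T c \<phi> x u" using k by (auto simp: costs_def)
    obtain z where z: "ext x u z" using ext_ex[OF xu(1)] by blast
    have "dist (z T) (z 0) \<le> M * dist T 0" using lipschitz_onD[OF ext_lip[OF xu(1) z], of T 0] T by auto
    moreover have "dist (snd (z T)) (snd (z 0)) \<le> dist (z T) (z 0)" by (rule dist_snd_le)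
    ultimately show ?thesis using z T xu(2) by (auto simp: ext_def dist_real_def)
  qed
  then have bdd: "bdd_below costs" by (auto simp: bdd_below_def)
  define k where "k = Inf costs"
  have "\<exists>x u. admissible T K x0 \<phi> Q x u \<and> cost T c \<phi> x u < k + 1 / Suc j" for j
    using cInf_lessD[OF costs_ne, of "k + 1 / Suc j"] by (auto simp: k_def costs_def)
  then obtain xs us where xu: "\<And>j. admissible T K x0 \<phi> Q (xs j) (us j)" "\<And>j. cost T c \<phi> (xs j) (us j) < k + 1 / Suc j"
    by metis
  have k_le: "k \<le> cost T c \<phi> x u" if "admissible T K x0 \<phi> Q x u" for x u
    unfolding k_def using that by (intro cInf_lower bdd) (auto simp: costs_def)
  have "\<forall>j. \<exists>z. ext (xs j) (us j) z" using ext_ex xu(1) by blast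
  then obtain zs where zs: "\<And>j. ext (xs j) (us j) (zs j)" by metis
  have zlip: "M-lipschitz_on {0..T} (zs j)" for j by (rule ext_lip[OF xu(1) zs])
  have z0: "zs j 0 = (x0, 0)" for j using zs[of j] by (simp add: ext_def)
  have "\<exists>g r. continuous_on {0..T} g \<and> strict_mono (r :: nat \<Rightarrow> nat) \<and>
      (\<forall>e>0. \<exists>J. \<forall>j s. J \<le> j \<and> s \<in> {0..T} \<longrightarrow> norm (zs (r j) s - g s) < e)"
  proof (rule Arzela_Ascoli[of "{0..T}" zs "norm (x0, 0::real) + M * T"])
    fix j s assume s: "s \<in> {0..T}"
    have "norm (zs j s - zs j 0) \<le> M * dist s 0"
      using lipschitz_onD[OF zlip[of j] s, of 0] T by (simp add: dist_norm)
    also have "\<dots> \<le> M * T" using s M by (intro mult_left_mono) auto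
    finally show "norm (zs j s) \<le> norm (x0, 0::real) + M * T"
      using norm_triangle_sub[of "zs j s" "zs j 0"] z0[of j] by simp
  next
    fix s e :: real assume s: "s \<in> {0..T}" "0 < e"
    show "\<exists>d>0. \<forall>j y. y \<in> {0..T} \<and> norm (s - y) < d \<longrightarrow> norm (zs j s - zs j y) < e"
    proof (intro exI[of _ "e / (M + 1)"] conjI allI impI)
      fix j y assume y: "y \<in> {0..T} \<and> norm (s - y) < e / (M + 1)"
      have "norm (zs j s - zs j y) \<le> M * norm (s - y)"
        using lipschitz_onD[OF zlip[of j] s(1), of y] y by (simp add: dist_norm)
      also have "\<dots> \<le> (M + 1) * norm (s - y)" by (intro mult_right_mono) auto
      also have "\<dots> < e" using y M by (simp add: field_simps)
      finally show "norm (zs j s - zs j y) < e" .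
    qed (use s M in auto)
  next
    fix g and r :: "nat \<Rightarrow> nat"
    assume "continuous_on {0..T} g" "strict_mono r" 
      "\<And>e. 0 < e \<Longrightarrow> \<exists>J. \<forall>j s. J \<le> j \<and> s \<in> {0..T} \<longrightarrow> norm (zs (r j) s - g s) < e"
    then show ?thesis by blast
  qed simp
  then obtain g and r :: "nat \<Rightarrow> nat" where g: "continuous_on {0..T} g" "strict_mono r"
    "\<And>e. 0 < e \<Longrightarrow> \<exists>J. \<forall>j s. J \<le> j \<and> s \<in> {0..T} \<longrightarrow> norm (zs (r j) s - g s) < e"
    by blast
  have glim: "(\<lambda>j. zs (r j) s) \<longlonglongrightarrow> g s" if "s \<in> {0..T}" for s
    unfolding LIMSEQ_def dist_norm using g(3) that by meson
  have glip: "M-lipschitz_on {0..T} g"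
  proof (rule lipschitz_onI[OF _ M])
    fix s t assume st: "s \<in> {0..T}" "t \<in> {0..T}"
    have "(\<lambda>j. dist (zs (r j) s) (zs (r j) t)) \<longlonglongrightarrow> dist (g s) (g t)"
      by (intro tendsto_dist glim st)
    then show "dist (g s) (g t) \<le> M * dist s t"
      by (rule LIMSEQ_le_const2) (use lipschitz_onD[OF zlip st] in auto)
  qed
  \<comment> \<open>Extending the limit by its endpoint values makes it Lipschitz on the whole line.\<close>
  define cl where "cl t = max 0 (min T t)" for t
  have cl: "cl t \<in> {0..T}" "t \<in> {0..T} \<Longrightarrow> cl t = t" for t using T by (auto simp: cl_def)
  define z where "z t = g (cl t)" for t
  have zg: "z t = g t" if "t \<in> {0..T}" for t using cl(2)[OF that] by (simp add: z_def)
  have z_lip: "M-lipschitz_on UNIV z"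
  proof (rule lipschitz_onI[OF _ M])
    fix s t
    have "dist (z s) (z t) \<le> M * dist (cl s) (cl t)"
      unfolding z_def by (rule lipschitz_onD[OF glip cl(1) cl(1)])
    also have "\<dots> \<le> M * dist s t"
      using M by (intro mult_left_mono) (auto simp: cl_def dist_real_def)
    finally show "dist (z s) (z t) \<le> M * dist s t" .
  qed
  have zc: "continuous_on S z" for S
    using lipschitz_on_continuous_on[OF z_lip] continuous_on_subset by blast
  obtain Z where Z: "Z \<in> null_sets lborel" "\<And>t. t \<notin> Z \<Longrightarrow> z differentiable (at t)"
    using lipschitz_AE_differentiable[OF z_lip] by blast
  have Zneg: "negligible Z" using Z(1) by (simp add: negligible_iff_null_sets null_sets_completionI)
  define x where "x t = fst (z t)" for t
  have xc: "continuous_on S x" for S unfolding x_def[abs_def] by (intro continuous_on_fst zc)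
  \<comment> \<open>The derivative as a limit of a sequence of continuous functions, hence Borel; where the limit does not
    exist, \<open>lim\<close> supplies a value that only matters on a null set.\<close>
  define W where "W n t = real (Suc n) *\<^sub>R (z (t + 1 / real (Suc n)) - z t)" for n t
  define w where "w t = lim (\<lambda>n. W n t)" for t
  have Wm: "W n \<in> borel_measurable borel" for n
    unfolding W_def[abs_def]
    by (intro borel_measurable_continuous_onI continuous_intros continuous_on_compose2[OF zc[of UNIV]]) auto
  have wm: "w \<in> borel_measurable borel"
    unfolding w_def[abs_def] by (rule borel_measurable_lim_metric) (rule Wm)
  have zder: "(z has_vector_derivative w t) (at t)" if tZ: "t \<notin> Z" for t
  proof -
    obtain d where d: "(z has_vector_derivative d) (at t)"
      using Z(2)[OF tZ] by (metis vector_derivative_works)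
    have "((\<lambda>h. norm (z (t + h) - z t - h *\<^sub>R d) / norm h) \<longlongrightarrow> 0) (at 0)"
      using d by (simp add: has_vector_derivative_def has_derivative_at)
    moreover have "filterlim (\<lambda>n. 1 / real (Suc n)) (at 0) sequentially"
      unfolding filterlim_at using LIMSEQ_inverse_real_of_nat by (auto simp: inverse_eq_divide)
    ultimately have quot: "(\<lambda>n. norm (z (t + 1 / real (Suc n)) - z t - (1 / real (Suc n)) *\<^sub>R d) / norm (1 / real (Suc n))) \<longlonglongrightarrow> 0"
      by (rule filterlim_compose)
    have "norm (z (t + 1 / real (Suc n)) - z t - (1 / real (Suc n)) *\<^sub>R d) / norm (1 / real (Suc n)) = norm (W n t - d)" for n
    proof -
      have "W n t - d = real (Suc n) *\<^sub>R (z (t + 1 / real (Suc n)) - z t - (1 / real (Suc n)) *\<^sub>R d)"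
        by (simp add: W_def scaleR_diff_right del: of_nat_Suc)
      then show ?thesis by (simp add: mult.commute del: of_nat_Suc)
    qed
    then have "(\<lambda>n. W n t - d) \<longlonglongrightarrow> 0" using quot by (simp add: tendsto_norm_zero_iff)
    then have "(\<lambda>n. W n t) \<longlonglongrightarrow> d" by (rule LIM_zero_cancel)
    then have "w t = d" by (simp add: w_def limI)
    then show ?thesis using d by simp
  qed
  have relaxed: "\<exists>m\<in>Lambda_set K \<phi>. w t = (\<Sum>i\<in>UNIV. m $ i *\<^sub>R A i (x t))" if t: "t \<in> {0<..<T} - Z" for t
  proof (rule velocity_of_limit_in_relaxed_velocities[OF K(1) \<phi> A, where u="\<lambda>j. us (r j)" and x="\<lambda>j. xs (r j)" and z="\<lambda>j. zs (r j)" and zl=z and xl=x and T=T])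
    show "t \<in> {0<..<T}" "(z has_vector_derivative w t) (at t)" using t zder by auto
    show "us (r j) \<in> borel_measurable (lebesgue_on {0<..<T})" "AE s in lebesgue_on {0<..<T}. us (r j) s \<in> K" for j
      using xu(1)[of "r j"] by (auto simp: admissible_def L_infinity_def)
    show "((\<lambda>\<tau>. \<Sum>i\<in>UNIV. \<phi> i (us (r j) \<tau>) *\<^sub>R A i (xs (r j) \<tau>)) has_integral zs (r j) b - zs (r j) a) {a..b}"
      if "0 \<le> a" "a \<le> b" "b \<le> T" for j a b
      using zs[of "r j"] that unfolding ext_def E_def[abs_def] by blast
    show "(\<lambda>j. zs (r j) s) \<longlonglongrightarrow> z s" if "s \<in> {0..T}" for s
      using glim[OF that] zg[OF that] by simp
    show "continuous_on {0..T} x" by (rule xc)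
    show "\<exists>J. \<forall>j\<ge>J. \<forall>s\<in>{0..T}. norm (xs (r j) s - x s) < e" if e: "e > 0" for e
    proof -
      obtain J where J: "\<And>j s. J \<le> j \<Longrightarrow> s \<in> {0..T} \<Longrightarrow> norm (zs (r j) s - g s) < e" using g(3)[OF e] by blast
      have "norm (xs (r j) s - x s) < e" if "j \<ge> J" "s \<in> {0..T}" for j s
      proof -
        have "fst (zs (r j) s) = xs (r j) s" "fst (g s) = x s"
          using zs[of "r j"] that(2) zg[OF that(2)] by (simp_all add: ext_def x_def)
        then show ?thesis
          using J[OF that] dist_fst_le[of "zs (r j) s" "g s"] by (simp add: dist_norm)
      qed
      then show ?thesis by blast
    qed
  qed
  \<comment> \<open>The parameter is \<open>p = (x(t), (x'(t), y'(t)))\<close>, and its section in \<open>G\<close> consists of the control values that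
    produce the velocity \<open>x'(t)\<close> at a cost rate of at most \<open>y'(t)\<close>.\<close>
  define G where "G = {(p, v). v \<in> K \<and> (\<Sum>i\<in>UNIV. \<phi> i v *\<^sub>R Q i (fst p)) = fst (snd p) \<and>
      (\<Sum>i\<in>UNIV. c i (fst p) * \<phi> i v)\<le> snd (snd p)}"
  have "closed (G)"
  proof -
    have \<phi>': "continuous_on S (\<lambda>q :: ((real ^ 'N) \<times> (real ^ 'N) \<times> real) \<times> (real ^ 'n). \<phi> i (snd q))" for i S
      by (rule continuous_on_compose2[OF \<phi>]) (auto intro: continuous_intros)
    have Q': "continuous_on S (\<lambda>q :: ((real ^ 'N) \<times> (real ^ 'N) \<times> real) \<times> (real ^ 'n). Q i (fst (fst q)))" for i S
      by (rule continuous_on_compose2[OF Q]) (auto intro!: continuous_intros)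
    have c': "continuous_on S (\<lambda>q :: ((real ^ 'N) \<times> (real ^ 'N) \<times> real) \<times> (real ^ 'n). c i (fst (fst q)))" for i S
      by (rule continuous_on_compose2[OF c]) (auto intro!: continuous_intros)
    have "G = (snd -` K) \<inter> {q. (\<Sum>i\<in>UNIV. \<phi> i (snd q) *\<^sub>R Q i (fst (fst q))) = fst (snd (fst q))}
       \<inter> {q. (\<Sum>i\<in>UNIV. c i (fst (fst q)) * \<phi> i (snd q)) \<le> snd (snd (fst q))}"
      by (auto simp: G_def)
    also have "closed \<dots>"
      by (intro closed_Int closed_vimage_snd compact_imp_closed K closed_Collect_eq closed_Collect_le
          continuous_on_sum continuous_on_scaleR continuous_on_mult \<phi>' Q' c' continuous_intros)
    finally show ?thesis .
  qed
  then obtain \<sigma> where \<sigma>: "\<sigma> \<in> borel_measurable borel" "\<And>p. (\<exists>v\<in>K. (p, v) \<in> G) \<Longrightarrow> \<sigma> p \<in> K \<and> (p, \<sigma> p) \<in> G"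
    using borel_lexicographic_selection[OF _ K(1)] by blast
  define u where "u t = \<sigma> (x t, w t)" for t
  have xm: "x \<in> borel_measurable borel" using xc borel_measurable_continuous_onI by blast
  have um: "u \<in> borel_measurable borel"
    unfolding u_def[abs_def] using xm wm
    by (intro measurable_compose[OF _ \<sigma>(1)]) (simp add: borel_prod[symmetric])
  have u: "u t \<in> K" "(\<Sum>i\<in>UNIV. \<phi> i (u t) *\<^sub>R Q i (x t)) = fst (w t)" "(\<Sum>i\<in>UNIV. c i (x t) * \<phi> i (u t)) \<le> snd (w t)"
    if t: "t \<in> {0<..<T} - Z" for t
  proof -
    obtain m where m: "m \<in> Lambda_set K \<phi>" "w t = (\<Sum>i\<in>UNIV. m $ i *\<^sub>R A i (x t))" using relaxed[OF t] by blast
    have "fst (w t) = (\<Sum>i\<in>UNIV. m $ i *\<^sub>R Q i (x t))" "snd (w t) = (\<Sum>i\<in>UNIV. c i (x t) * m $ i)"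
      by (simp_all add: m(2) A_def fst_sum snd_sum mult.commute)
    then have "\<exists>v\<in>K. ((x t, w t), v) \<in> G"
      using realize[OF m(1), of "x t"] by (auto simp: G_def)
    then have "u t \<in> K \<and> ((x t, w t), u t) \<in> G" unfolding u_def by (rule \<sigma>(2))
    then show "u t \<in> K" "(\<Sum>i\<in>UNIV. \<phi> i (u t) *\<^sub>R Q i (x t)) = fst (w t)" "(\<Sum>i\<in>UNIV. c i (x t) * \<phi> i (u t)) \<le> snd (w t)"
      by (auto simp: G_def)
  qed
  have ul: "u \<in> borel_measurable (lebesgue_on {0<..<T})"
    using um by (simp add: measurable_completion measurable_restrict_space1)
  have uK: "AE t in lebesgue_on {0<..<T}. u t \<in> K"
    using Zneg u(1) by (subst AE_lebesgue_on_iff_negligible) auto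
  have x0: "x 0 = x0"
  proof -
    have "(\<lambda>j. zs (r j) 0) \<longlonglongrightarrow> g 0" using T by (intro glim) auto
    then have "g 0 = (x0, 0)" by (simp add: z0 LIMSEQ_const_iff)
    then show ?thesis using T by (simp add: x_def zg)
  qed
  have zT: "snd (z T) = k" "snd (z 0) = 0"
  proof -
    have "(\<lambda>j. snd (zs (r j) T)) \<longlonglongrightarrow> snd (g T)" using T by (intro tendsto_snd glim) auto
    then have lim1: "(\<lambda>j. cost T c \<phi> (xs (r j)) (us (r j))) \<longlonglongrightarrow> snd (g T)"
      using zs by (simp add: ext_def)
    have "(\<lambda>j. cost T c \<phi> (xs j) (us j)) \<longlonglongrightarrow> k"
    proof (rule tendsto_sandwich)
      show "(\<lambda>j. k) \<longlonglongrightarrow> k" by simp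
      show "(\<lambda>j. k + 1 / real (Suc j)) \<longlonglongrightarrow> k"
        using LIMSEQ_inverse_real_of_nat_add[of k] by (simp add: inverse_eq_divide)
    qed (use k_le[OF xu(1)] xu(2) in \<open>auto intro!: always_eventually less_imp_le\<close>)
    then have "(\<lambda>j. cost T c \<phi> (xs (r j)) (us (r j))) \<longlonglongrightarrow> k"
      using LIMSEQ_subseq_LIMSEQ[OF _ g(2)] by (auto simp: o_def)
    then have "snd (g T) = k" using lim1 LIMSEQ_unique by blast
    then show "snd (z T) = k" using T by (simp add: zg)
    have "(\<lambda>j. zs (r j) 0) \<longlonglongrightarrow> g 0" using T by (intro glim) auto
    then have "g 0 = (x0, 0)" by (simp add: z0 LIMSEQ_const_iff)
    then show "snd (z 0) = 0" using T by (simp add: zg)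
  qed
  have zac: "abs_continuous_on 0 T z"
    by (rule lipschitz_imp_abs_continuous_on[OF lipschitz_on_subset[OF z_lip]]) simp
  have xlip: "M-lipschitz_on {0..T} x"
  proof (rule lipschitz_onI[OF _ M])
    fix s t
    have "dist (x s) (x t) \<le> dist (z s) (z t)" unfolding x_def by (rule dist_fst_le)
    also have "\<dots> \<le> M * dist s t" by (rule lipschitz_onD[OF z_lip UNIV_I UNIV_I])
    finally show "dist (x s) (x t) \<le> M * dist s t" .
  qed
  have xder: "(x has_vector_derivative (\<Sum>i\<in>UNIV. \<phi> i (u t) *\<^sub>R Q i (x t))) (at t)" if t: "t \<in> {0<..<T} - Z" for t
  proof -
    have "(x has_vector_derivative fst (w t)) (at t)"
      unfolding x_def[abs_def]
      using bounded_linear.has_vector_derivative[OF bounded_linear_fst zder] t by auto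
    then show ?thesis by (simp only: u(2)[OF t])
  qed
  have adm: "admissible T K x0 \<phi> Q x u"
    unfolding admissible_def L_infinity_def
  proof (intro conjI)
    obtain b where b: "\<And>v. v \<in> K \<Longrightarrow> norm v \<le> b" using compact_imp_bounded[OF K(1)] by (auto simp: bounded_iff)
    have "AE t in lebesgue_on {0<..<T}. norm (u t) \<le> b" using uK by eventually_elim (rule b)
    then show "\<exists>B. AE t in lebesgue_on {0<..<T}. norm (u t) \<le> B" by blast
    show "abs_continuous_on 0 T x" by (rule lipschitz_imp_abs_continuous_on[OF xlip])
    show "AE t in lebesgue_on {0<..<T}. (x has_vector_derivative (\<Sum>i\<in>UNIV. \<phi> i (u t) *\<^sub>R Q i (x t))) (at t)"
      using Zneg xder by (subst AE_lebesgue_on_iff_negligible) auto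
  qed (use ul uK x0 in auto)
  have "cost T c \<phi> x u \<le> k"
  proof -
    obtain zx where zx: "ext x u zx" using ext_ex[OF adm] by blast
    then have "(E x u has_integral zx T - zx 0) {0..T}" unfolding ext_def using less_imp_le[OF T] by blast
    then have "(snd \<circ> E x u has_integral snd (zx T - zx 0)) {0..T}" by (rule has_integral_linear[OF _ bounded_linear_snd])
    then have c1: "(snd \<circ> E x u has_integral cost T c \<phi> x u) {0..T}" using zx by (simp add: ext_def)
    have "(w has_integral z T - z 0) {0..T}"
      using T zder by (intro abs_continuous_on_has_integral_derivative[OF _ zac Zneg]) auto
    then have "(snd \<circ> w has_integral snd (z T - z 0)) {0..T}" by (rule has_integral_linear[OF _ bounded_linear_snd])
    then have c2: "(snd \<circ> w has_integral k) {0..T}" using zT by simp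
    define Z' where "Z' = Z \<union> {0, T}"
    have Z': "negligible Z'" using Zneg by (simp add: Z'_def negligible_Un negligible_insert)
    have c1': "((\<lambda>t. if t \<in> Z' then 0 else (snd \<circ> E x u) t) has_integral cost T c \<phi> x u) {0..T}"
      by (rule has_integral_spike[OF Z' _ c1]) simp
    have c2': "((\<lambda>t. if t \<in> Z' then 0 else (snd \<circ> w) t) has_integral k) {0..T}"
      by (rule has_integral_spike[OF Z' _ c2]) simp
    show ?thesis
    proof (rule has_integral_le[OF c1' c2'])
      fix t assume "t \<in> {0..T}"
      then show "(if t \<in> Z' then 0 else (snd \<circ> E x u) t) \<le> (if t \<in> Z' then 0 else (snd \<circ> w) t)"
        using u(3)[of t] by (auto simp: Z'_def E_def A_def snd_sum mult.commute)
    qed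
  qed
  then show ?thesis using adm k_le by (meson order_trans)
qed

theorem theorem1p3:
  fixes T :: real
    and K :: "(real ^ 'n::finite) set"
    and x0 :: "real ^ 'N::finite"
    and c :: "'s::finite \<Rightarrow> real ^ 'N \<Rightarrow> real"
    and \<phi> :: "'s \<Rightarrow> real ^ 'n \<Rightarrow> real"
    and Q :: "'s \<Rightarrow> real ^ 'N \<Rightarrow> real ^ 'N"
  assumes "T > 0"
    and "compact K" and "K \<noteq> {}"
    and "\<And>i. continuous_on UNIV (c i)"
    and "\<And>i. C1_function (\<phi> i)"
    and "\<And>i. \<exists>C. C-lipschitz_on UNIV (Q i)"
    and "\<And>x \<xi> m. \<xi> \<in> (\<lambda>m. Q_matrix Q x *v m) ` Lambda_set K \<phi> \<Longrightarrow>
           is_arg_min (\<lambda>m. vec_of c x \<bullet> m)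
             (\<lambda>m. m \<in> Lambda_set K \<phi> \<and> \<xi> = Q_matrix Q x *v m) m \<Longrightarrow>
           m \<in> L_set K \<phi>"
  shows "\<exists>u. solution_P1 T K x0 c \<phi> Q u"
proof -
  have \<phi>: "continuous_on UNIV (\<phi> i)" for i
    by (rule C1_function_imp_continuous_on) (rule assms(5))
  have "\<exists>x u. admissible T K x0 \<phi> Q x u \<and>
     (\<forall>y v. admissible T K x0 \<phi> Q y v \<longrightarrow> cost T c \<phi> x u \<le> cost T c \<phi> y v)"
  proof (rule optimal_control_exists[where \<phi>=\<phi> and Q=Q and c=c, OF assms(1-3) \<phi> assms(4,6)])
    fix x m assume m: "m \<in> Lambda_set K \<phi>"
    show "\<exists>v\<in>K. (\<Sum>i\<in>UNIV. \<phi> i v *\<^sub>R Q i x) = (\<Sum>i\<in>UNIV. m $ i *\<^sub>R Q i x) \<and>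
        (\<Sum>i\<in>UNIV. c i x * \<phi> i v) \<le> (\<Sum>i\<in>UNIV. c i x * m $ i)"
      by (rule control_realizing_relaxed_velocity[where \<phi>=\<phi> and Q=Q and c=c, OF assms(2) \<phi> assms(7) m])
  qed
  then show ?thesis
    by (auto simp: solution_P1_def is_arg_min_def not_less)
qed

end
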